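(* Let $Y$ be a finite ultrametric space. Then the following are equivalent: (i) $Y$ is homogeneous; (ii) $Y$ is ultrahomogeneous; (iii) $Y$ is ultraextensive.
   Context: $Y$ is homogeneous if for all $x,y\in Y$ there is an isometry of $Y$ mapping $x$ to $y$; ultrahomogeneous if every isometry between subsets of $Y$ (partial isometry) extends to an isometry of $Y$. $\mathcal{P}_X$ is the set of partial isometries of $X$ not contained in the identity. For a finite metric space $X$, an S-extension is $(Z,\phi)$ with $Z$ a metric space extending $X$ and $\phi:\mathcal{P}_X\to\mathrm{Iso}(Z)$ with $\phi(p)\restriction\mathrm{dom}(p)=p$; assuming $\phi(p^{-1})=\phi(p)^{-1}$, $\phi$ extends to a homomorphism from the free group $\mathbb{F}(\mathcal{P}_X)$ to $\mathrm{Iso}(Z)$. It is minimal if every $z\in Z$ is $\phi(g)(x)$ for some $g\in\mathbb{F}(\mathcal{P}_X)$, $x\in X$. For finite $X_1\subseteq X_2$ and S-extensions $(Z_i,\phi_i)$ of $X_i$, they are coherent if $Z_2$ extends $Z_1$, $\phi_2(p)$ extends $\phi_1(p)$ for all $p\in\mathcal{P}_{X_1}$, and $\phi_1(p)\mapsto\phi_2(p)$ extends uniquely to an injective group homomorphism $\phi_1(\mathbb{F}(\mathcal{P}_{X_1}))\to\phi_2(\mathbb{F}(\mathcal{P}_{X_2}))$. A metric space $U$ is ultraextensive if: (i) $U$ is ultrahomogeneous; (ii) every finite $X\subseteq U$ has a finite S-extension $(Z,\phi)$ with $Z\subseteq U$; (iii) whenever $X_1\subseteq X_2\subseteq U$ are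 finite and $(Z_1,\phi_1)$ is a finite minimal S-extension of $X_1$ with $Z_1\subseteq U$, there is a finite minimal S-extension $(Z_2,\phi_2)$ of $X_2$ with $Z_2\subseteq U$ coherent with $(Z_1,\phi_1)$. *)

theory Defs
  imports "HOL-Analysis.Abstract_Metric_Spaces" "HOL-Algebra.Bij"
begin

section \<open>The free group on a set\<close>

text \<open>
  The letter \<open>(s, True)\<close> stands for the generator \<open>s\<close> and \<open>(s, False)\<close> for its formal inverse.
  The elements of the free group are the reduced words.
\<close>

definition cancels :: "'s \<times> bool \<Rightarrow> 's \<times> bool \<Rightarrow> bool" where
  "cancels a b \<longleftrightarrow> fst a = fst b \<and> snd a \<noteq> snd b"

definition reduced :: "('s \<times> bool) list \<Rightarrow> bool" where
  "reduced w \<longleftrightarrow> successively (\<lambda>a b. \<not> cancels a b) w"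

fun prepend :: "'s \<times> bool \<Rightarrow> ('s \<times> bool) list \<Rightarrow> ('s \<times> bool) list" where
  "prepend a [] = [a]"
| "prepend a (b # w) = (if cancels a b then w else a # b # w)"

definition free_group :: "'s set \<Rightarrow> ('s \<times> bool) list monoid" where
  "free_group S =
    \<lparr>carrier = {w \<in> lists (S \<times> UNIV). reduced w},
     mult = (\<lambda>u v. foldr prepend u v),
     one = []\<rparr>"

text \<open>The extension of a map from the generators to a group \<open>G\<close> to all of the free group.\<close>

definition free_ext :: "('g, 'm) monoid_scheme \<Rightarrow> ('s \<Rightarrow> 'g) \<Rightarrow> ('s \<times> bool) list \<Rightarrow> 'g" where
  "free_ext G \<phi> w =
    foldr (\<lambda>(s, b) g. (if b then \<phi> s else inv\<^bsub>G\<^esub> (\<phi> s)) \<otimes>\<^bsub>G\<^esub> g) w \<one>\<^bsub>G\<^esub>"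

lemma reduced_Nil [simp]: "reduced []"
  by (simp add: reduced_def)

lemma reduced_tl: "reduced (a # w) \<Longrightarrow> reduced w"
  by (cases w) (auto simp: reduced_def)

lemma reduced_prepend: "reduced w \<Longrightarrow> reduced (prepend a w)"
  by (cases w) (auto simp: reduced_def dest: reduced_tl[unfolded reduced_def])

lemma reduced_foldr_prepend: "reduced v \<Longrightarrow> reduced (foldr prepend u v)"
  by (induction u) (auto intro: reduced_prepend)

lemma prepend_reduced: "reduced (a # w) \<Longrightarrow> prepend a w = a # w"
  by (cases w) (auto simp: reduced_def)

lemma foldr_prepend_Nil: "reduced w \<Longrightarrow> foldr prepend w [] = w"
proof (induction w)
  case (Cons a w)
  then show ?case using reduced_tl[OF Cons.prems] prepend_reduced[OF Cons.prems] by simp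
qed simp

lemma prepend_prepend: "cancels a b \<Longrightarrow> reduced w \<Longrightarrow> prepend a (prepend b w) = w"
proof (cases w)
  case (Cons c v)
  assume *: "cancels a b" "reduced w"
  show ?thesis
  proof (cases "cancels b c")
    case True
    with *(1) have "c = a" by (auto simp: cancels_def prod_eq_iff)
    with *(2) Cons True show ?thesis by (simp add: prepend_reduced)
  qed (use * Cons in simp)
qed simp

lemma foldr_prepend_prepend:
  assumes "reduced v" "reduced w"
  shows "foldr prepend (prepend a v) w = prepend a (foldr prepend v w)"
proof (cases v)
  case (Cons b v')
  with assms show ?thesis
    by (auto simp: prepend_prepend reduced_foldr_prepend)
qed simp

lemma foldr_prepend_assoc:
  assumes "reduced v" "reduced w"
  shows "foldr prepend (foldr prepend u v) w = foldr prepend u (foldr prepend v w)"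
  using assms
  by (induction u) (auto simp: foldr_prepend_prepend reduced_foldr_prepend)

lemma prepend_in_lists: "a \<in> A \<Longrightarrow> w \<in> lists A \<Longrightarrow> prepend a w \<in> lists A"
  by (cases w) auto

lemma foldr_prepend_in_lists: "u \<in> lists A \<Longrightarrow> w \<in> lists A \<Longrightarrow> foldr prepend u w \<in> lists A"
proof (induction u)
  case (Cons a u)
  then have "foldr prepend u w \<in> lists A" "a \<in> A" by auto
  then show ?case unfolding foldr.simps o_apply by (intro prepend_in_lists)
qed simp

lemma foldr_prepend_inverse:
  "reduced w \<Longrightarrow> foldr prepend (rev (map (\<lambda>(s, b). (s, \<not> b)) w)) w = []"
proof (induction w)
  case (Cons a w)
  then show ?case by (auto simp: cancels_def split: prod.splits dest: reduced_tl)
qed simp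

lemma group_free_group: "group (free_group S)"
proof (rule groupI)
  fix w assume w: "w \<in> carrier (free_group S)"
  let ?v = "foldr prepend (rev (map (\<lambda>(s, b). (s, \<not> b)) w)) []"
  have "?v \<in> carrier (free_group S)"
  proof -
    have "?v \<in> lists (S \<times> UNIV)"
      by (rule foldr_prepend_in_lists) (use w in \<open>auto simp: free_group_def\<close>)
    then show ?thesis by (simp add: free_group_def reduced_foldr_prepend)
  qed
  moreover have "?v \<otimes>\<^bsub>free_group S\<^esub> w = \<one>\<^bsub>free_group S\<^esub>"
    using w by (simp add: free_group_def foldr_prepend_assoc foldr_prepend_inverse)
  ultimately show "\<exists>v\<in>carrier (free_group S). v \<otimes>\<^bsub>free_group S\<^esub> w = \<one>\<^bsub>free_group S\<^esub>"
    by blast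
qed (auto simp: free_group_def reduced_foldr_prepend foldr_prepend_assoc foldr_prepend_in_lists
        simp del: in_lists_conv_set)

lemma free_ext_closed:
  assumes "group G" "\<phi> \<in> S \<rightarrow> carrier G" "w \<in> lists (S \<times> UNIV)"
  shows "free_ext G \<phi> w \<in> carrier G"
proof -
  interpret group G by fact
  show ?thesis
    using assms(3)
  proof (induction w)
    case (Cons a w)
    then have "free_ext G \<phi> w \<in> carrier G" "\<phi> (fst a) \<in> carrier G"
      using assms(2) by auto
    then show ?case by (auto simp: free_ext_def split: prod.splits)
  qed (simp add: free_ext_def)
qed

lemma free_ext_prepend:
  assumes "group G" "\<phi> \<in> S \<rightarrow> carrier G" "w \<in> lists (S \<times> UNIV)" "fst a \<in> S"
  shows "free_ext G \<phi> (prepend a w) =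
    (if snd a then \<phi> (fst a) else inv\<^bsub>G\<^esub> (\<phi> (fst a))) \<otimes>\<^bsub>G\<^esub> free_ext G \<phi> w"
proof (cases w)
  case Nil
  then show ?thesis by (simp add: free_ext_def split: prod.splits)
next
  case (Cons b w')
  interpret group G by fact
  have 1: "free_ext G \<phi> w' \<in> carrier G" and 2: "\<phi> (fst a) \<in> carrier G"
    using assms Cons by (auto intro!: free_ext_closed[OF assms(1,2)])
  have 3: "free_ext G \<phi> (c # v) =
      (if snd c then \<phi> (fst c) else inv\<^bsub>G\<^esub> (\<phi> (fst c))) \<otimes>\<^bsub>G\<^esub> free_ext G \<phi> v" for c v
    by (simp add: free_ext_def split: prod.splits)
  show ?thesis
    using 1 2 by (auto simp: Cons 3 cancels_def simp flip: m_assoc)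
qed

lemma free_ext_hom:
  assumes "group G" "\<phi> \<in> S \<rightarrow> carrier G"
  shows "free_ext G \<phi> \<in> hom (free_group S) G"
proof (rule homI)
  interpret group G by fact
  fix u v assume u: "u \<in> carrier (free_group S)" and v: "v \<in> carrier (free_group S)"
  have "u \<in> lists (S \<times> UNIV)" "v \<in> lists (S \<times> UNIV)"
    using u v by (auto simp: free_group_def)
  then have "free_ext G \<phi> (foldr prepend u v) = free_ext G \<phi> u \<otimes>\<^bsub>G\<^esub> free_ext G \<phi> v"
  proof (induction u)
    case Nil
    then show ?case using free_ext_closed[OF assms] by (simp add: free_ext_def)
  next
    case (Cons a u)
    then have a: "fst a \<in> S" and u: "u \<in> lists (S \<times> UNIV)" by auto
    have 2: "\<phi> (fst a) \<in> carrier G" using a assms by auto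
    have 3: "free_ext G \<phi> (a # u) =
        (if snd a then \<phi> (fst a) else inv\<^bsub>G\<^esub> (\<phi> (fst a))) \<otimes>\<^bsub>G\<^esub> free_ext G \<phi> u"
      by (simp add: free_ext_def split: prod.splits)
    show ?case
      using Cons free_ext_closed[OF assms] u 2 a
      by (simp add: free_ext_prepend[OF assms foldr_prepend_in_lists] 3 m_assoc
           del: in_lists_conv_set)
  qed
  then show "free_ext G \<phi> (u \<otimes>\<^bsub>free_group S\<^esub> v) = free_ext G \<phi> u \<otimes>\<^bsub>G\<^esub> free_ext G \<phi> v"
    by (simp add: free_group_def)
qed (auto simp: free_group_def intro: free_ext_closed[OF assms])

lemma free_ext_generator:
  assumes "group G" "\<phi> \<in> S \<rightarrow> carrier G" "s \<in> S"
  shows "free_ext G \<phi> [(s, True)] = \<phi> s"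
proof -
  interpret group G by fact
  have "\<phi> s \<in> carrier G" using assms by auto
  then show ?thesis by (simp add: free_ext_def)
qed


section \<open>Metric spaces and their isometries\<close>

locale Ultrametric_space = Metric_space +
  assumes ultrametric:
    "\<lbrakk>x \<in> M; y \<in> M; z \<in> M\<rbrakk> \<Longrightarrow> d x z \<le> max (d x y) (d y z)"

definition isometry_between ::
    "('a \<Rightarrow> 'a \<Rightarrow> real) \<Rightarrow> 'a set \<Rightarrow> 'a set \<Rightarrow> ('a \<Rightarrow> 'a) \<Rightarrow> bool" where
  "isometry_between d A B f \<longleftrightarrow>
    bij_betw f A B \<and> (\<forall>x\<in>A. \<forall>y\<in>A. d (f x) (f y) = d x y)"

text \<open>The group of isometries from \<open>M\<close> onto \<open>M\<close>, as a subgroup of all permutations of \<open>M\<close>.\<close>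

definition Iso :: "'a set \<Rightarrow> ('a \<Rightarrow> 'a \<Rightarrow> real) \<Rightarrow> ('a \<Rightarrow> 'a) monoid" where
  "Iso M d = (BijGroup M)\<lparr>carrier := {f \<in> Bij M. isometry_between d M M f}\<rparr>"

lemma group_Iso: "group (Iso M d)"
proof -
  interpret B: group "BijGroup M" by (rule group_BijGroup)
  have "subgroup {f \<in> Bij M. isometry_between d M M f} (BijGroup M)"
  proof (rule B.subgroupI)
    fix f assume "f \<in> {f \<in> Bij M. isometry_between d M M f}"
    then have f: "f \<in> Bij M" and fd: "\<And>x y. x \<in> M \<Longrightarrow> y \<in> M \<Longrightarrow> d (f x) (f y) = d x y"
      by (auto simp: isometry_between_def)
    have b: "bij_betw f M M" using f by (simp add: Bij_def)
    let ?g = "restrict (inv_into M f) M"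
    have g: "?g \<in> Bij M" using f by (rule restrict_inv_into_Bij)
    have "d (?g x) (?g y) = d x y" if "x \<in> M" "y \<in> M" for x y
      using fd[of "?g x" "?g y"] that b f
      by (simp add: Bij_inv_into_mem bij_betw_inv_into_right)
    moreover have "inv\<^bsub>BijGroup M\<^esub> f = ?g" using f by (rule inv_BijGroup)
    ultimately show "inv\<^bsub>BijGroup M\<^esub> f \<in> {f \<in> Bij M. isometry_between d M M f}"
      using g by (auto simp: isometry_between_def Bij_def)
  next
    fix f g
    assume "f \<in> {f \<in> Bij M. isometry_between d M M f}"
      and "g \<in> {f \<in> Bij M. isometry_between d M M f}"
    then have f: "f \<in> Bij M" "isometry_between d M M f"
      and g: "g \<in> Bij M" "isometry_between d M M g" by auto
    have "compose M f g \<in> Bij M" using f g by (simp add: compose_Bij)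
    moreover have "d (compose M f g x) (compose M f g y) = d x y" if "x \<in> M" "y \<in> M" for x y
    proof -
      have "g x \<in> M" "g y \<in> M" using Bij_imp_funcset[OF g(1)] that by auto
      with f g that show ?thesis by (auto simp: compose_def isometry_between_def)
    qed
    ultimately show "f \<otimes>\<^bsub>BijGroup M\<^esub> g \<in> {f \<in> Bij M. isometry_between d M M f}"
      using f g by (auto simp: BijGroup_def isometry_between_def Bij_def)
  next
    show "{f \<in> Bij M. isometry_between d M M f} \<noteq> {}"
      using id_Bij[of M] by (auto simp: isometry_between_def Bij_def intro!: exI[of _ "restrict id M"])
  qed (auto simp: BijGroup_def)
  then show ?thesis unfolding Iso_def by (rule B.subgroup_imp_group)
qed

definition homogeneous :: "'a set \<Rightarrow> ('a \<Rightarrow> 'a \<Rightarrow> real) \<Rightarrow> bool" where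
  "homogeneous Y d \<longleftrightarrow> (\<forall>x\<in>Y. \<forall>y\<in>Y. \<exists>f\<in>carrier (Iso Y d). f x = y)"

definition ultrahomogeneous :: "'a set \<Rightarrow> ('a \<Rightarrow> 'a \<Rightarrow> real) \<Rightarrow> bool" where
  "ultrahomogeneous Y d \<longleftrightarrow>
    (\<forall>A B f. A \<subseteq> Y \<longrightarrow> B \<subseteq> Y \<longrightarrow> isometry_between d A B f \<longrightarrow>
      (\<exists>g\<in>carrier (Iso Y d). \<forall>x\<in>A. g x = f x))"


section \<open>S-extensions\<close>

text \<open>
  A partial isometry is represented by its graph, so that its inverse is the converse relation
  and containment in the identity is literal.
\<close>

definition partial_isometries :: "'a set \<Rightarrow> ('a \<Rightarrow> 'a \<Rightarrow> real) \<Rightarrow> ('a \<times> 'a) set set" where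
  "partial_isometries X d =
    {(\<lambda>x. (x, f x)) ` A | A B f. A \<subseteq> X \<and> B \<subseteq> X \<and> isometry_between d A B f}"

definition nonid_partial_isometries :: "'a set \<Rightarrow> ('a \<Rightarrow> 'a \<Rightarrow> real) \<Rightarrow> ('a \<times> 'a) set set" where
  "nonid_partial_isometries X d = {p \<in> partial_isometries X d. \<not> p \<subseteq> Id}"

text \<open>
  \<open>X\<close> is a subspace of \<open>Z\<close>, so one distance function \<open>d\<close> serves both. The values of \<open>\<phi>\<close> outside
  \<open>nonid_partial_isometries X d\<close> are irrelevant. The usual normalisation that \<open>\<phi>\<close> respects
  inverses is part of the definition.
\<close>

definition S_extension ::
    "('a \<Rightarrow> 'a \<Rightarrow> real) \<Rightarrow> 'a set \<Rightarrow> 'a set \<Rightarrow> (('a \<times> 'a) set \<Rightarrow> 'a \<Rightarrow> 'a) \<Rightarrow> bool" where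
  "S_extension d X Z \<phi> \<longleftrightarrow>
    Metric_space Z d \<and> finite X \<and> X \<subseteq> Z \<and>
    (\<forall>p\<in>nonid_partial_isometries X d.
      \<phi> p \<in> carrier (Iso Z d) \<and>
      (\<forall>(x, y)\<in>p. \<phi> p x = y) \<and>
      \<phi> (p\<inverse>) = inv\<^bsub>Iso Z d\<^esub> (\<phi> p))"

abbreviation free_isometries :: "('a \<Rightarrow> 'a \<Rightarrow> real) \<Rightarrow> 'a set \<Rightarrow> (('a \<times> 'a) set \<times> bool) list monoid" where
  "free_isometries d X \<equiv> free_group (nonid_partial_isometries X d)"

definition minimal_S_extension ::
    "('a \<Rightarrow> 'a \<Rightarrow> real) \<Rightarrow> 'a set \<Rightarrow> 'a set \<Rightarrow> (('a \<times> 'a) set \<Rightarrow> 'a \<Rightarrow> 'a) \<Rightarrow> bool" where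
  "minimal_S_extension d X Z \<phi> \<longleftrightarrow>
    S_extension d X Z \<phi> \<and>
    (\<forall>z\<in>Z. \<exists>g\<in>carrier (free_isometries d X). \<exists>x\<in>X. z = free_ext (Iso Z d) \<phi> g x)"

definition image_group ::
    "('a \<Rightarrow> 'a \<Rightarrow> real) \<Rightarrow> 'a set \<Rightarrow> 'a set \<Rightarrow> (('a \<times> 'a) set \<Rightarrow> 'a \<Rightarrow> 'a) \<Rightarrow> ('a \<Rightarrow> 'a) monoid" where
  "image_group d X Z \<phi> =
    (Iso Z d)\<lparr>carrier := free_ext (Iso Z d) \<phi> ` carrier (free_isometries d X)\<rparr>"

text \<open>
  Homomorphisms are taken to be \<open>extensional\<close> so that uniqueness refers to their values on the
  group only.
\<close>

definition coherent ::
    "('a \<Rightarrow> 'a \<Rightarrow> real) \<Rightarrow> 'a set \<Rightarrow> 'a set \<Rightarrow> (('a \<times> 'a) set \<Rightarrow> 'a \<Rightarrow> 'a) \<Rightarrow>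
      'a set \<Rightarrow> 'a set \<Rightarrow> (('a \<times> 'a) set \<Rightarrow> 'a \<Rightarrow> 'a) \<Rightarrow> bool" where
  "coherent d X\<^sub>1 Z\<^sub>1 \<phi>\<^sub>1 X\<^sub>2 Z\<^sub>2 \<phi>\<^sub>2 \<longleftrightarrow>
    Z\<^sub>1 \<subseteq> Z\<^sub>2 \<and>
    (\<forall>p\<in>nonid_partial_isometries X\<^sub>1 d. \<forall>z\<in>Z\<^sub>1. \<phi>\<^sub>2 p z = \<phi>\<^sub>1 p z) \<and>
    (\<exists>!h. h \<in> hom (image_group d X\<^sub>1 Z\<^sub>1 \<phi>\<^sub>1) (image_group d X\<^sub>2 Z\<^sub>2 \<phi>\<^sub>2) \<and>
          h \<in> extensional (carrier (image_group d X\<^sub>1 Z\<^sub>1 \<phi>\<^sub>1)) \<and>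
          inj_on h (carrier (image_group d X\<^sub>1 Z\<^sub>1 \<phi>\<^sub>1)) \<and>
          (\<forall>p\<in>nonid_partial_isometries X\<^sub>1 d. h (\<phi>\<^sub>1 p) = \<phi>\<^sub>2 p))"

definition ultraextensive :: "'a set \<Rightarrow> ('a \<Rightarrow> 'a \<Rightarrow> real) \<Rightarrow> bool" where
  "ultraextensive U d \<longleftrightarrow>
    ultrahomogeneous U d \<and>
    (\<forall>X. X \<subseteq> U \<longrightarrow> finite X \<longrightarrow> (\<exists>Z \<phi>. Z \<subseteq> U \<and> finite Z \<and> S_extension d X Z \<phi>)) \<and>
    (\<forall>X\<^sub>1 X\<^sub>2 Z\<^sub>1 \<phi>\<^sub>1. X\<^sub>1 \<subseteq> X\<^sub>2 \<longrightarrow> X\<^sub>2 \<subseteq> U \<longrightarrow> finite X\<^sub>2 \<longrightarrow>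
      Z\<^sub>1 \<subseteq> U \<longrightarrow> finite Z\<^sub>1 \<longrightarrow> minimal_S_extension d X\<^sub>1 Z\<^sub>1 \<phi>\<^sub>1 \<longrightarrow>
      (\<exists>Z\<^sub>2 \<phi>\<^sub>2. Z\<^sub>2 \<subseteq> U \<and> finite Z\<^sub>2 \<and> minimal_S_extension d X\<^sub>2 Z\<^sub>2 \<phi>\<^sub>2 \<and>
        coherent d X\<^sub>1 Z\<^sub>1 \<phi>\<^sub>1 X\<^sub>2 Z\<^sub>2 \<phi>\<^sub>2))"

end

theory Submission
  imports Defs
begin

text \<open>
  In a homogeneous finite ultrametric space all closed balls of the same radius split into the same
  number of open balls of that radius, so partial isometries extend one point at a time. In an
  ultrahomogeneous one, all partial isometries can even be extended simultaneously in a way that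
  respects composition. Applied to \<open>Iso Z\<^sub>1\<close>, such an extension turns \<open>\<phi>\<^sub>1\<close> into an action on
  the whole space; \<open>Z\<^sub>2\<close> is the orbit of \<open>X\<^sub>2\<close> under the extended partial isometries of \<open>X\<^sub>2\<close>.
  Compatibility with composition also makes \<open>\<phi>\<^sub>2\<close> respect inverses, including the case \<open>p = p\<inverse>\<close>,
  where the extension has to be an involution.
\<close>

section \<open>Isometries\<close>

lemma isometry_betweenI:
  assumes "f ` A = B" "\<And>x y. x \<in> A \<Longrightarrow> y \<in> A \<Longrightarrow> d (f x) (f y) = d x y" "inj_on f A"
  shows "isometry_between d A B f"
  using assms by (auto simp: isometry_between_def bij_betw_def)

lemma isometry_betweenD:
  assumes "isometry_between d A B f"
  shows "f ` A = B" "x \<in> A \<Longrightarrow> f x \<in> B" "inj_on f A" "bij_betw f A B"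
    "x \<in> A \<Longrightarrow> y \<in> A \<Longrightarrow> d (f x) (f y) = d x y"
  using assms by (auto simp: isometry_between_def bij_betw_def)

lemma carrier_Iso: "f \<in> carrier (Iso Z d) \<longleftrightarrow> f \<in> extensional Z \<and> isometry_between d Z Z f"
  by (auto simp: Iso_def Bij_def isometry_between_def)

lemma IsoD:
  assumes "f \<in> carrier (Iso Z d)"
  shows "f ` Z = Z" "x \<in> Z \<Longrightarrow> f x \<in> Z" "inj_on f Z" "bij_betw f Z Z" "f \<in> extensional Z"
    "x \<in> Z \<Longrightarrow> y \<in> Z \<Longrightarrow> d (f x) (f y) = d x y" "isometry_between d Z Z f"
  using assms isometry_betweenD[of d Z Z f] by (auto simp: carrier_Iso)

lemma mult_Iso:
  assumes "f \<in> carrier (Iso Z d)" "g \<in> carrier (Iso Z d)"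
  shows "f \<otimes>\<^bsub>Iso Z d\<^esub> g = compose Z f g"
  using assms by (auto simp: Iso_def BijGroup_def)

lemma one_Iso: "\<one>\<^bsub>Iso Z d\<^esub> = (\<lambda>x\<in>Z. x)"
  by (simp add: Iso_def BijGroup_def)

lemma inv_Iso_apply:
  assumes "f \<in> carrier (Iso Z d)" "x \<in> Z"
  shows "(inv\<^bsub>Iso Z d\<^esub> f) (f x) = x"
proof -
  interpret group "Iso Z d" by (rule group_Iso)
  have "inv\<^bsub>Iso Z d\<^esub> f \<otimes>\<^bsub>Iso Z d\<^esub> f = \<one>\<^bsub>Iso Z d\<^esub>"
    using assms by simp
  then have "compose Z (inv\<^bsub>Iso Z d\<^esub> f) f x = x"
    using assms by (simp add: mult_Iso one_Iso)
  with assms show ?thesis by (simp add: compose_def)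
qed

lemma apply_inv_Iso:
  assumes "f \<in> carrier (Iso Z d)" "x \<in> Z"
  shows "f ((inv\<^bsub>Iso Z d\<^esub> f) x) = x"
proof -
  interpret group "Iso Z d" by (rule group_Iso)
  show ?thesis using inv_Iso_apply[of "inv\<^bsub>Iso Z d\<^esub> f" Z d x] assms by simp
qed

lemma Iso_eqI:
  assumes "f \<in> carrier (Iso Z d)" "g \<in> carrier (Iso Z d)" "\<And>x. x \<in> Z \<Longrightarrow> f x = g x"
  shows "f = g"
  using assms by (intro extensionalityI[of _ Z]) (auto simp: carrier_Iso)

text \<open>The identification of points at distance zero holds only inside \<open>M\<close>, which
  is why the image has to lie in \<open>M\<close> as well.\<close>

lemma isometric_inj_on:
  assumes "Metric_space M d" "A \<subseteq> M" "\<And>x y. x \<in> A \<Longrightarrow> y \<in> A \<Longrightarrow> d (f x) (f y) = d x y"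
    "f ` A \<subseteq> M"
  shows "inj_on f A"
proof (rule inj_onI)
  interpret Metric_space M d by fact
  fix x y assume *: "x \<in> A" "y \<in> A" "f x = f y"
  then have "d x y = d (f y) (f y)" using assms(3)[of x y] by simp
  also have "\<dots> = 0" using * assms by (auto intro!: mdist_zero)
  finally show "x = y" using * assms(2) zero[of x y] by auto
qed

text \<open>An injective self-map of a finite set is onto, so surjectivity comes for free;
  \<open>restrict\<close> supplies the extensionality that \<open>Iso\<close> demands.\<close>

lemma isometric_surjective_Iso:
  assumes "Metric_space M d" "finite M" "f ` M \<subseteq> M"
    "\<And>x y. x \<in> M \<Longrightarrow> y \<in> M \<Longrightarrow> d (f x) (f y) = d x y"
  shows "restrict f M \<in> carrier (Iso M d)"
proof -
  have inj: "inj_on f M" using isometric_inj_on[OF assms(1), of M f] assms by auto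
  then have "f ` M = M" using assms(2,3) by (simp add: endo_inj_surj)
  with inj assms(4) show ?thesis
    by (auto simp: carrier_Iso intro!: isometry_betweenI)
qed


section \<open>Homogeneity implies ultrahomogeneity\<close>

text \<open>On \<open>S\<close> the map \<open>F\<close> factors through \<open>E\<close>. Later
  \<open>E\<close> and \<open>F\<close> send a point to the open ball about it and about its image,
  which compares the numbers of balls met.\<close>

lemma card_image_le_of_factor:
  assumes "finite S" "\<And>a b. a \<in> S \<Longrightarrow> b \<in> S \<Longrightarrow> E a = E b \<Longrightarrow> F a = F b"
  shows "card (F ` S) \<le> card (E ` S)"
proof (rule surj_card_le)
  show "F ` S \<subseteq> (\<lambda>X. F (inv_into S E X)) ` E ` S"
  proof
    fix u assume "u \<in> F ` S"
    then obtain a where a: "a \<in> S" "u = F a" by auto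
    then have "F (inv_into S E (E a)) = F a"
      by (intro assms(2)) (auto intro: inv_into_into f_inv_into_f)
    with a show "u \<in> (\<lambda>X. F (inv_into S E X)) ` E ` S" by (metis imageI)
  qed
qed (use assms(1) in simp)

section \<open>Ultrametric balls and extension by one point\<close>

context Ultrametric_space
begin

text \<open>The ultrametric inequality, applied with \<open>z\<close> and then \<open>y\<close>
  reached last, bounds each of the two longer sides by the other.\<close>

lemma isosceles:
  assumes "x \<in> M" "y \<in> M" "z \<in> M" "d x y < d y z"
  shows "d x z = d y z"
  using ultrametric[of x y z] ultrametric[of y x z] commute[of x y] assms by auto

text \<open>Every point of an ultrametric ball is a centre, so open balls of a fixed positive radius
  are the classes of the equivalence relation "closer than \<open>r\<close>".\<close>

lemma mball_eq_iff:
  assumes "x \<in> M" "y \<in> M" "0 < r"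
  shows "mball x r = mball y r \<longleftrightarrow> d x y < r"
proof
  assume "mball x r = mball y r"
  moreover have "y \<in> mball y r" using assms by simp
  ultimately show "d x y < r" by auto
next
  assume xy: "d x y < r"
  have "d u z < r" if "d u v < r" "d v z < r" "u \<in> M" "v \<in> M" "z \<in> M" for u v z
    using ultrametric[of u v z] that by auto
  from this[of x y] this[of y x] show "mball x r = mball y r"
    using xy assms commute[of x y] by (auto simp: in_mball)
qed

lemma Iso_image_mball:
  assumes "g \<in> carrier (Iso M d)" "x \<in> M"
  shows "g ` mball x r = mball (g x) r"
proof (intro equalityI subsetI)
  fix v assume v: "v \<in> mball (g x) r"
  then obtain u where "u \<in> M" "v = g u" using IsoD(1)[OF assms(1)] by auto
  with v show "v \<in> g ` mball x r" using assms IsoD(6)[OF assms(1), of x u] by auto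
qed (use assms IsoD[OF assms(1)] in auto)

text \<open>
  Let \<open>r\<close> be the distance from \<open>y\<close> to \<open>A\<close>, attained at \<open>z\<close>. By homogeneity the closed balls of
  radius \<open>r\<close> about \<open>z\<close> and \<open>f z\<close> split into the same number of open balls of radius \<open>r\<close>, and
  \<open>A\<close> misses one of the former, so \<open>f ` A\<close> misses one of the latter.
\<close>

lemma one_point_extension:
  assumes fin: "finite M" and hom: "homogeneous M d"
    and A: "A \<subseteq> M" and fA: "f ` A \<subseteq> M"
    and f: "\<And>x y. x \<in> A \<Longrightarrow> y \<in> A \<Longrightarrow> d (f x) (f y) = d x y"
    and y: "y \<in> M"
  obtains y' where "y' \<in> M" "\<And>a. a \<in> A \<Longrightarrow> d y' (f a) = d y a"
proof (cases "A = {} \<or> y \<in> A")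
  case True
  then show ?thesis
  proof
    assume "y \<in> A"
    then show ?thesis using that[of "f y"] fA f by auto
  qed (use y that in auto)
next
  case False
  have finA: "finite A" using A fin finite_subset by blast
  obtain z where z: "z \<in> A" "\<And>a. a \<in> A \<Longrightarrow> d y z \<le> d y a"
    using Min_in[of "d y ` A"] Min_le[of "d y ` A"] finA False by fastforce
  define r where "r = d y z"
  have r: "0 < r" using False z y A mdist_pos_eq[of y z] by (auto simp: r_def)
  have zM: "z \<in> M" "f z \<in> M" using z A fA by auto
  \<comment> \<open>Only points of \<open>A\<close> within \<open>r\<close> of \<open>z\<close>
    constrain the choice of ball; the farther ones are settled by the isosceles property.\<close>
  define S where "S = A \<inter> mcball z r"
  have SA: "S \<subseteq> A" by (simp add: S_def)
  have SM: "\<And>s. s \<in> S \<Longrightarrow> s \<in> M" "\<And>s. s \<in> S \<Longrightarrow> f s \<in> M" using SA A fA by auto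
  have fS: "f ` S \<subseteq> mcball (f z) r"
    using z f A fA zM by (auto simp: S_def)
  obtain g where g: "g \<in> carrier (Iso M d)" "g z = f z"
    using hom zM by (auto simp: homogeneous_def)
  let ?b = "\<lambda>x. mball x r"
  have g_mcball: "g ` mcball z r = mcball (f z) r"
  proof (intro equalityI subsetI)
    fix v assume v: "v \<in> mcball (f z) r"
    then obtain u where "u \<in> M" "v = g u" using IsoD(1)[OF g(1)] by auto
    with v show "v \<in> g ` mcball z r" using g zM IsoD(6)[OF g(1), of z u] by auto
  qed (use g zM IsoD[OF g(1)] in fastforce)
  have "?b ` mcball (f z) r = (`) g ` ?b ` mcball z r"
    using Iso_image_mball[OF g(1)] by (auto simp: image_image simp flip: g_mcball)
  moreover have "inj_on ((`) g) (?b ` mcball z r)"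
    using inj_on_image_Pow[OF IsoD(3)[OF g(1)]] by (rule inj_on_subset) auto
  ultimately have card_eq: "card (?b ` mcball (f z) r) = card (?b ` mcball z r)"
    by (simp add: card_image)
  \<comment> \<open>Since \<open>f\<close> preserves distances, points of \<open>S\<close> in a
    common open ball have images in a common open ball.\<close>
  have "card (?b ` f ` S) \<le> card (?b ` S)"
    unfolding image_image
    using mball_eq_iff[OF _ _ r] f SM SA finite_subset[OF SA finA]
    by (intro card_image_le_of_factor) (auto simp: subset_iff)
  \<comment> \<open>The open ball about \<open>y\<close> is the one that is missed: \<open>y\<close>
    lies at distance \<open>r\<close> from \<open>z\<close>, and no point of \<open>A\<close> is
    closer to \<open>y\<close> than \<open>r\<close>.\<close>
  also have "\<dots> < card (?b ` mcball z r)"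
  proof (intro psubset_card_mono psubsetI)
    show "finite (?b ` mcball z r)" 
      by (intro finite_imageI finite_subset[OF _ fin]) auto
    show "?b ` S \<subseteq> ?b ` mcball z r" by (auto simp: S_def)
    have "?b y \<in> ?b ` mcball z r"
      using y zM commute[of y z] by (auto simp: r_def)
    moreover have "?b y \<notin> ?b ` S"
      using mball_eq_iff[OF y _ r] z SA SM by (fastforce simp: r_def)
    ultimately show "?b ` S \<noteq> ?b ` mcball z r" by blast
  qed
  finally have "card (?b ` f ` S) < card (?b ` mcball (f z) r)" using card_eq by simp
  then have "\<not> ?b ` mcball (f z) r \<subseteq> ?b ` f ` S"
    using card_mono[of "?b ` f ` S" "?b ` mcball (f z) r"] finite_subset[OF SA finA] by auto
  then obtain y' where y': "y' \<in> mcball (f z) r" "?b y' \<notin> ?b ` f ` S" by blast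
  have y'M: "y' \<in> M" using y' by auto
  show ?thesis
  proof (rule that[OF y'M])
    fix a assume a: "a \<in> A"
    have aM: "a \<in> M" "f a \<in> M" using a A fA by auto
    have fza: "d (f z) (f a) = d z a" using f z a by simp
    have y'z: "d y' (f z) \<le> r" using y' commute by auto
    show "d y' (f a) = d y a"
    \<comment> \<open>Up to distance \<open>r\<close> from \<open>z\<close>, both sides equal
      \<open>r\<close>; beyond it, the isosceles property makes both equal to
      \<open>d z a\<close>.\<close>
    proof (cases "d z a \<le> r")
      case True
      then have aS: "a \<in> S" using a aM zM by (auto simp: S_def)
      then have "?b y' \<noteq> ?b (f a)" using y' by blast
      then have "d y' (f a) \<ge> r" using mball_eq_iff[OF y'M aM(2) r] by auto
      moreover have "d y' (f a) \<le> r"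
        using ultrametric[OF y'M zM(2) aM(2)] y'z fza True by auto
      moreover have "d y a = r"
        using ultrametric[OF y zM(1) aM(1)] z(2)[OF a] True by (auto simp: r_def)
      ultimately show ?thesis by simp
    next
      case False
      then show ?thesis
        using isosceles[OF y zM(1) aM(1)] isosceles[OF y'M zM(2) aM(2)] y'z fza
        by (auto simp: r_def)
    qed
  qed
qed

text \<open>Induction on the number of points outside \<open>A\<close>. Assuming only preservation
  of distances lets the map be updated at one point without tracking injectivity or the target
  set.\<close>

lemma isometric_extension:
  assumes fin: "finite M" and hom: "homogeneous M d"
    and "A \<subseteq> M" "f ` A \<subseteq> M" "\<And>x y. x \<in> A \<Longrightarrow> y \<in> A \<Longrightarrow> d (f x) (f y) = d x y"
  shows "\<exists>g\<in>carrier (Iso M d). \<forall>x\<in>A. g x = f x"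
  using assms(3-5)
proof (induction "card (M - A)" arbitrary: A f)
  case 0
  then have "A = M" using fin by auto
  with 0 show ?case
    by (intro bexI[of _ "restrict f M"] isometric_surjective_Iso) (auto simp: fin Metric_space_axioms)
next
  case (Suc n)
  then obtain y where y: "y \<in> M" "y \<notin> A"
    by (metis Diff_eq_empty_iff card.empty nat.distinct(1) subsetI)
  obtain y' where y': "y' \<in> M" "\<And>a. a \<in> A \<Longrightarrow> d y' (f a) = d y a"
    using one_point_extension[OF fin hom Suc.prems y(1)] by blast
  have "M - A = insert y (M - insert y A)" using y by auto
  then have "n = card (M - insert y A)" using Suc.hyps(2) fin
    by (metis Diff_iff card_insert_disjoint diff_Suc_1 finite_Diff insertI1)
  moreover have "insert y A \<subseteq> M" "(f(y := y')) ` insert y A \<subseteq> M"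
    using Suc.prems y y' by auto
  moreover have "d ((f(y := y')) u) ((f(y := y')) v) = d u v"
    if "u \<in> insert y A" "v \<in> insert y A" for u v
    using that Suc.prems y y' commute by auto
  ultimately have "\<exists>g\<in>carrier (Iso M d). \<forall>x\<in>insert y A. g x = (f(y := y')) x"
    by (intro Suc.hyps(1)) blast+
  then show ?case using y by (metis fun_upd_other insertCI)
qed

text \<open>Homogeneity is the extension property for partial isometries between singletons.\<close>

lemma homogeneous_iff_ultrahomogeneous:
  assumes "finite M"
  shows "homogeneous M d \<longleftrightarrow> ultrahomogeneous M d"
proof
  assume hom: "homogeneous M d"
  show "ultrahomogeneous M d"
    unfolding ultrahomogeneous_def
  proof (intro allI impI)
    fix A B f assume "A \<subseteq> M" "B \<subseteq> M" and f: "isometry_between d A B f"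
    then show "\<exists>g\<in>carrier (Iso M d). \<forall>x\<in>A. g x = f x"
      using isometry_betweenD(1,5)[OF f] by (intro isometric_extension[OF assms hom]) simp_all
  qed
next
  assume uh: "ultrahomogeneous M d"
  show "homogeneous M d"
    unfolding homogeneous_def
  proof (intro ballI)
    fix x y assume "x \<in> M" "y \<in> M"
    moreover from this have "isometry_between d {x} {y} (\<lambda>_. y)"
      by (intro isometry_betweenI) auto
    ultimately show "\<exists>f\<in>carrier (Iso M d). f x = y"
      using uh[unfolded ultrahomogeneous_def, rule_format, of "{x}" "{y}" "\<lambda>_. y"] by auto
  qed
qed

end


section \<open>Functorial extension of partial isometries\<close>

text \<open>
  The points of \<open>M\<close> are sorted by their position relative to \<open>A\<close>: the distance to \<open>A\<close> and the set
  of nearest points. Points in different positions have their distance determined by the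
  positions, so an isometry from \<open>A\<close> to \<open>B\<close> can be extended position by position; making
  the choices once for every orbit of positions renders the extension compatible with composition.
\<close>

locale finite_ultrahomogeneous = Ultrametric_space +
  assumes finite_M: "finite M" and ultrahomogeneous_M: "ultrahomogeneous M d"
begin

interpretation Iso: group "Iso M d" by (rule group_Iso)

lemma extend_isometry:
  assumes "A \<subseteq> M" "B \<subseteq> M" "isometry_between d A B f"
  obtains g where "g \<in> carrier (Iso M d)" "\<And>x. x \<in> A \<Longrightarrow> g x = f x"
  using ultrahomogeneous_M[unfolded ultrahomogeneous_def, rule_format, OF assms] that by blast

text \<open>Including \<open>A\<close> itself makes any isometry that moves one position to another
  also carry one base set onto the other. For empty \<open>A\<close> all points share one position,
  whatever the value of \<open>Min {}\<close>.\<close>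

definition position :: "'a set \<Rightarrow> 'a \<Rightarrow> 'a set \<times> 'a set \<times> real" where
  "position A y = (A, {a \<in> A. d y a = Min (d y ` A)}, Min (d y ` A))"

text \<open>Only values on the base set enter for a position, so a partial isometry moves it exactly
  as any of its extensions does.\<close>

definition move :: "('a \<Rightarrow> 'a) \<Rightarrow> 'a set \<times> 'a set \<times> real \<Rightarrow> 'a set \<times> 'a set \<times> real" where
  "move g k = (g ` fst k, g ` fst (snd k), snd (snd k))"

definition positions :: "('a set \<times> 'a set \<times> real) set" where
  "positions = {k. fst k \<subseteq> M \<and> fst (snd k) \<subseteq> M}"

definition orbit :: "'a set \<times> 'a set \<times> real \<Rightarrow> ('a set \<times> 'a set \<times> real) set" where
  "orbit k = {move g k | g. g \<in> carrier (Iso M d)}"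

text \<open>The choice depends on the orbit as a set only, so all positions of one orbit get
  literally the same representative.\<close>

definition rep :: "'a set \<times> 'a set \<times> real \<Rightarrow> 'a set \<times> 'a set \<times> real" where
  "rep k = (SOME k'. k' \<in> orbit k)"

text \<open>Composing one transport with the inverse of another gives isometries between the
  positions of one orbit that compose consistently.\<close>

definition transport :: "'a set \<times> 'a set \<times> real \<Rightarrow> 'a \<Rightarrow> 'a" where
  "transport k = (SOME t. t \<in> carrier (Iso M d) \<and> move t (rep k) = k)"

text \<open>The point is pulled back to the representative of its position and pushed out to the
  moved position. Restriction to \<open>M\<close> gives extensionality.\<close>

definition extend_iso :: "'a set \<Rightarrow> ('a \<Rightarrow> 'a) \<Rightarrow> 'a \<Rightarrow> 'a" where
  "extend_iso A f = (\<lambda>y\<in>M. transport (move f (position A y))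
    ((inv\<^bsub>Iso M d\<^esub> (transport (position A y))) y))"

section \<open>The isometry group acting on positions\<close>

lemma position_in_positions: "A \<subseteq> M \<Longrightarrow> position A y \<in> positions"
  by (auto simp: position_def positions_def)

lemma move_in_positions: "g \<in> carrier (Iso M d) \<Longrightarrow> k \<in> positions \<Longrightarrow> move g k \<in> positions"
  by (auto simp: move_def positions_def subset_iff dest: IsoD(2))

lemma move_mult:
  assumes "f \<in> carrier (Iso M d)" "g \<in> carrier (Iso M d)" "k \<in> positions"
  shows "move (f \<otimes>\<^bsub>Iso M d\<^esub> g) k = move f (move g k)"
proof -
  have "compose M f g ` A = f ` g ` A" if "A \<subseteq> M" for A
    using that by (force simp: compose_def image_image subset_iff)
  with assms show ?thesis by (simp add: move_def mult_Iso positions_def)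
qed

lemma move_one: "k \<in> positions \<Longrightarrow> move \<one>\<^bsub>Iso M d\<^esub> k = k"
  by (cases k) (force simp: move_def positions_def one_Iso)

lemma orbit_move:
  assumes g: "g \<in> carrier (Iso M d)" and k: "k \<in> positions"
  shows "orbit (move g k) = orbit k"
proof (intro equalityI subsetI)
  fix k' assume "k' \<in> orbit (move g k)"
  then obtain f where "f \<in> carrier (Iso M d)" "k' = move f (move g k)"
    by (auto simp: orbit_def)
  then show "k' \<in> orbit k"
    using g k by (auto simp: orbit_def simp flip: move_mult)
next
  fix k' assume "k' \<in> orbit k"
  then obtain f where f: "f \<in> carrier (Iso M d)" "k' = move f k"
    by (auto simp: orbit_def)
  have "(f \<otimes>\<^bsub>Iso M d\<^esub> inv\<^bsub>Iso M d\<^esub> g) \<otimes>\<^bsub>Iso M d\<^esub> g = f"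
    using f g by (simp add: Iso.m_assoc)
  then have "move (f \<otimes>\<^bsub>Iso M d\<^esub> inv\<^bsub>Iso M d\<^esub> g) (move g k) = k'"
    using f g k move_mult[of "f \<otimes>\<^bsub>Iso M d\<^esub> inv\<^bsub>Iso M d\<^esub> g" g k] by simp
  moreover have "f \<otimes>\<^bsub>Iso M d\<^esub> inv\<^bsub>Iso M d\<^esub> g \<in> carrier (Iso M d)"
    using f g by simp
  ultimately show "k' \<in> orbit (move g k)" by (auto simp: orbit_def)
qed

lemma rep_move: "g \<in> carrier (Iso M d) \<Longrightarrow> k \<in> positions \<Longrightarrow> rep (move g k) = rep k"
  by (simp add: rep_def orbit_move)

lemma rep_cases:
  assumes "k \<in> positions"
  obtains g where "g \<in> carrier (Iso M d)" "rep k = move g k"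
proof -
  have "move \<one>\<^bsub>Iso M d\<^esub> k \<in> orbit k" by (auto simp: orbit_def)
  then have "rep k \<in> orbit k" unfolding rep_def by (rule someI)
  with that show ?thesis by (auto simp: orbit_def)
qed

lemma rep_in_positions: "k \<in> positions \<Longrightarrow> rep k \<in> positions"
  by (metis rep_cases move_in_positions)

lemma transport:
  assumes "k \<in> positions"
  shows "transport k \<in> carrier (Iso M d)" "move (transport k) (rep k) = k"
proof -
  obtain g where g: "g \<in> carrier (Iso M d)" "rep k = move g k"
    using assms by (rule rep_cases)
  have "move (inv\<^bsub>Iso M d\<^esub> g) (rep k) = k"
    using g assms move_mult[of "inv\<^bsub>Iso M d\<^esub> g" g k] by (simp add: move_one)
  then have "\<exists>t. t \<in> carrier (Iso M d) \<and> move t (rep k) = k" using g by auto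
  from someI_ex[OF this] show "transport k \<in> carrier (Iso M d)" "move (transport k) (rep k) = k"
    by (simp_all add: transport_def)
qed

lemma position_Iso:
  assumes g: "g \<in> carrier (Iso M d)" and A: "A \<subseteq> M" and y: "y \<in> M"
  shows "position (g ` A) (g y) = move g (position A y)"
proof -
  have *: "d (g y) (g a) = d y a" if "a \<in> A" for a using IsoD(6)[OF g y] that A by auto
  then have "d (g y) ` g ` A = d y ` A" by (force simp: image_image)
  with * show ?thesis by (auto simp: position_def move_def)
qed

text \<open>Ultrahomogeneity provides a global \<open>g\<close> extending \<open>f\<close>, so the
  old and the moved position share an orbit. Hence one isometry of \<open>M\<close> computes the
  extension at \<open>y\<close>, and isometries respect positions.\<close>

lemma extend_iso_position:
  assumes A: "A \<subseteq> M" and B: "B \<subseteq> M" and f: "isometry_between d A B f" and y: "y \<in> M"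
  shows "extend_iso A f y \<in> M" "position B (extend_iso A f y) = move f (position A y)"
proof -
  obtain g where g: "g \<in> carrier (Iso M d)" and gf: "\<And>x. x \<in> A \<Longrightarrow> g x = f x"
    using extend_isometry[OF A B f] by blast
  define k where "k = position A y"
  have k: "k \<in> positions" using A by (simp add: k_def position_in_positions)
  have gk: "move f k = move g k" using gf by (force simp: k_def position_def move_def)
  have k': "move g k \<in> positions" using g k by (rule move_in_positions)
  \<comment> \<open>This is the isometry that \<open>extend_iso\<close> applies to all points in
    position \<open>k\<close>.\<close>
  define h where "h = transport (move g k) \<otimes>\<^bsub>Iso M d\<^esub> inv\<^bsub>Iso M d\<^esub> (transport k)"
  have t: "transport k \<in> carrier (Iso M d)" "transport (move g k) \<in> carrier (Iso M d)"
    using transport k k' by auto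
  then have h: "h \<in> carrier (Iso M d)" by (simp add: h_def)
  have "h \<otimes>\<^bsub>Iso M d\<^esub> transport k = transport (move g k)"
    using t by (simp add: h_def Iso.m_assoc)
  then have hk: "move h k = move g k"
    using move_mult[OF h t(1) rep_in_positions[OF k]] transport(2)[OF k] transport(2)[OF k']
    by (simp add: rep_move[OF g k])
  have E: "extend_iso A f y = h y"
    using t y by (simp add: extend_iso_def gk h_def mult_Iso compose_def flip: k_def)
  show "extend_iso A f y \<in> M" using E IsoD(2)[OF h y] by simp
  \<comment> \<open>Although \<open>h\<close> may differ from \<open>f\<close> on \<open>A\<close>,
    it has the right image, because the base set is part of the position.\<close>
  have "h ` A = g ` A" using hk by (auto simp: k_def move_def position_def)
  also have "\<dots> = B" using gf isometry_betweenD(1)[OF f] by force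
  finally show "position B (extend_iso A f y) = move f (position A y)"
    using position_Iso[OF h A y] E hk gk by (simp add: k_def)
qed

text \<open>Distances from a point to \<open>A\<close> are determined by one nearest point and the
  distance to it. Different positions then leave no freedom for the distance of the two points, by
  the isosceles property.\<close>

lemma dist_of_position:
  assumes A: "A \<subseteq> M" and y: "y \<in> M" "y' \<in> M" and ne: "position A y \<noteq> position A y'"
    and a: "a \<in> fst (snd (position A y))" "a' \<in> fst (snd (position A y'))"
  shows "d y y' = max (d a a') (max (snd (snd (position A y))) (snd (snd (position A y'))))"
proof -
  define r r' where "r = Min (d y ` A)" and "r' = Min (d y' ` A)"
  have fin: "finite A" using A finite_M finite_subset by blast
  have r: "r \<le> d y b" "r' \<le> d y' b" if "b \<in> A" for b
    using that fin by (simp_all add: r_def r'_def)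
  have a: "a \<in> A" "d y a = r" "a' \<in> A" "d y' a' = r'"
    using a by (auto simp: position_def r_def r'_def)
  have M: "a \<in> M" "a' \<in> M" using a A by auto
  have near: "d y b = max (d a b) r" "d y' b = max (d a' b) r'" if b: "b \<in> A" for b
  proof -
    have bM: "b \<in> M" using b A by auto
    have "d y b \<le> max r (d a b)" "d a b \<le> max r (d y b)"
      using ultrametric[OF y(1) M(1) bM] ultrametric[OF M(1) y(1) bM] a(2) commute[of y a] by simp_all
    with r(1)[OF b] show "d y b = max (d a b) r" by linarith
    have "d y' b \<le> max r' (d a' b)" "d a' b \<le> max r' (d y' b)"
      using ultrametric[OF y(2) M(2) bM] ultrametric[OF M(2) y(2) bM] a(4) commute[of y' a']
      by simp_all
    with r(2)[OF b] show "d y' b = max (d a' b) r'" by linarith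
  qed
  \<comment> \<open>Otherwise \<open>y\<close> and \<open>y'\<close> would have the same nearest
    points at the same distance, hence equal positions.\<close>
  have far: "r < d a a'" if rr: "r = r'"
  proof (rule ccontr)
    assume "\<not> r < d a a'"
    then have aa: "d a a' \<le> r" by simp
    have "d y b = r \<longleftrightarrow> d y' b = r" if b: "b \<in> A" for b
    proof -
      have bM: "b \<in> M" using b A by auto
      have "d a b \<le> max (d a a') (d a' b)" "d a' b \<le> max (d a a') (d a b)"
        using ultrametric[OF M(1) M(2) bM] ultrametric[OF M(2) M(1) bM] commute[of a a'] by simp_all
      then show ?thesis unfolding near[OF b] rr[symmetric] using aa by linarith
    qed
    then have "position A y = position A y'"
      using rr by (auto simp: position_def simp flip: r_def r'_def)
    with ne show False ..
  qed
  have "d y y' = max (d a a') (max r r')"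
  proof (cases r r' rule: linorder_cases)
    case less
    then show ?thesis
      using isosceles[OF y(1) M(1) y(2)] near(2)[OF a(1)] a(2) commute[of y' a] commute[of a a']
      by simp
  next
    case greater
    then show ?thesis
      using isosceles[OF y(2) M(2) y(1)] near(1)[OF a(3)] a(4) commute[of y a'] commute[of y y']
      by simp
  next
    case equal
    then show ?thesis
      using far isosceles[OF y(2) M(2) y(1)] near(1)[OF a(3)] a(4) commute[of y a']
        commute[of y y']
      by simp
  qed
  then show ?thesis by (simp add: position_def r_def r'_def)
qed

text \<open>Points in one position are moved by one common isometry; for points in different
  positions the distance is a function of position data that \<open>f\<close> preserves.\<close>

lemma extend_iso_isometric:
  assumes A: "A \<subseteq> M" and B: "B \<subseteq> M" and f: "isometry_between d A B f" and y: "y \<in> M" "y' \<in> M"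
  shows "d (extend_iso A f y) (extend_iso A f y') = d y y'"
proof (cases "position A y = position A y'")
  case True
  obtain g where g: "g \<in> carrier (Iso M d)" and gf: "\<And>x. x \<in> A \<Longrightarrow> g x = f x"
    using extend_isometry[OF A B f] by blast
  have "move f (position A y) = move g (position A y)"
    using gf by (force simp: position_def move_def)
  then have "transport (position A y) \<in> carrier (Iso M d)"
    "transport (move f (position A y)) \<in> carrier (Iso M d)"
    using transport(1) position_in_positions[OF A] move_in_positions[OF g] by auto
  with y show ?thesis
    by (simp add: extend_iso_def flip: True) (metis IsoD(2,6) Iso.inv_closed)
next
  case False
  then have "A \<noteq> {}" by (auto simp: position_def)
  moreover have "finite A" using A finite_M finite_subset by blast
  ultimately have "\<exists>a. a \<in> fst (snd (position A z))" for z
    using Min_in[of "d z ` A"] by (fastforce simp: position_def)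
  then obtain a a' where a: "a \<in> fst (snd (position A y))" "a' \<in> fst (snd (position A y'))"
    by blast
  then have aA: "a \<in> A" "a' \<in> A" by (auto simp: position_def)
  note E = extend_iso_position[OF A B f y(1)] extend_iso_position[OF A B f y(2)]
  have inj: "inj_on f A" using f by (rule isometry_betweenD)
  \<comment> \<open>Injectivity of \<open>f\<close> keeps distinct sets of nearest points
    distinct.\<close>
  have "position B (extend_iso A f y) \<noteq> position B (extend_iso A f y')"
    using False inj_on_image_eq_iff[OF inj] unfolding E
    by (auto simp: position_def move_def)
  from dist_of_position[OF B E(1,3) this, of "f a" "f a'"] show ?thesis
    using a dist_of_position[OF A y False a] isometry_betweenD(5)[OF f aA]
    unfolding E by (simp add: move_def)
qed

lemma extend_iso_closed:
  assumes A: "A \<subseteq> M" and B: "B \<subseteq> M" and f: "isometry_between d A B f"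
  shows "extend_iso A f \<in> carrier (Iso M d)"
proof -
  have "restrict (extend_iso A f) M \<in> carrier (Iso M d)"
    using extend_iso_isometric[OF assms] extend_iso_position(1)[OF assms] Metric_space_axioms finite_M
    by (intro isometric_surjective_Iso) auto
  then show ?thesis by (simp add: extend_iso_def)
qed

text \<open>A point of \<open>A\<close> is its own unique nearest point, at distance zero, and its
  image inherits this with \<open>f x\<close> as nearest point.\<close>

lemma extend_iso_eq:
  assumes A: "A \<subseteq> M" and B: "B \<subseteq> M" and f: "isometry_between d A B f" and x: "x \<in> A"
  shows "extend_iso A f x = f x"
proof -
  have fin: "finite A" using A finite_M finite_subset by blast
  have "Min (d x ` A) = 0"
    using x A fin by (intro Min_eqI) (auto intro!: image_eqI[of _ _ x])
  then have "position A x = (A, {x}, 0)"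
    using x A by (auto simp: position_def subset_iff)
  then have pos: "position B (extend_iso A f x) = (f ` A, {f x}, 0)"
    using extend_iso_position(2)[OF A B f, of x] x A by (auto simp: move_def)
  then have "f x \<in> B" "d (extend_iso A f x) (f x) = 0" by (auto simp: position_def set_eq_iff)
  moreover have "extend_iso A f x \<in> M" "f x \<in> M"
    using extend_iso_position(1)[OF A B f, of x] x A B calculation(1) by auto
  ultimately show ?thesis by (simp only: zero)
qed

text \<open>The transport to the intermediate position cancels against its inverse. This is the gain
  from choosing transports once and for all.\<close>

lemma extend_iso_mult:
  assumes "A \<subseteq> M" "B \<subseteq> M" "C \<subseteq> M" "isometry_between d A B f" "isometry_between d B C g"
    and h: "\<And>x. x \<in> A \<Longrightarrow> h x = g (f x)"
  shows "extend_iso A h = extend_iso B g \<otimes>\<^bsub>Iso M d\<^esub> extend_iso A f"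
proof -
  have E: "extend_iso A f \<in> carrier (Iso M d)" "extend_iso B g \<in> carrier (Iso M d)"
    using assms by (auto intro: extend_iso_closed)
  have "extend_iso A h y = extend_iso B g (extend_iso A f y)" if y: "y \<in> M" for y
  proof -
    define k where "k = position A y"
    have k: "k \<in> positions" using assms(1) by (simp add: k_def position_in_positions)
    have E': "extend_iso A f y \<in> M" "position B (extend_iso A f y) = move f k"
      using extend_iso_position[OF assms(1,2,4) y] by (simp_all add: k_def)
    have k': "move f k \<in> positions"
      using E'(2) position_in_positions[OF assms(2)] by metis
    have mv: "move h k = move g (move f k)"
      using h by (force simp: k_def move_def position_def)
    have Ef: "extend_iso A f y = transport (move f k) ((inv\<^bsub>Iso M d\<^esub> (transport k)) y)"
      using y by (simp add: extend_iso_def k_def)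
    have "(inv\<^bsub>Iso M d\<^esub> (transport k)) y \<in> M"
      by (rule IsoD(2)[of _ M d]) (simp_all add: transport(1)[OF k] y)
    \<comment> \<open>Both extensions pass through the same point at the common
      representative.\<close>
    then have "(inv\<^bsub>Iso M d\<^esub> (transport (move f k))) (extend_iso A f y) = (inv\<^bsub>Iso M d\<^esub> (transport k)) y"
      unfolding Ef using inv_Iso_apply[OF transport(1)[OF k']] by blast
    moreover have "extend_iso B g (extend_iso A f y) = transport (move g (move f k))
        ((inv\<^bsub>Iso M d\<^esub> (transport (move f k))) (extend_iso A f y))"
      using E' by (simp add: extend_iso_def[of B])
    ultimately show ?thesis using y mv by (simp add: extend_iso_def[of A h] k_def)
  qed
  then show ?thesis
    using E by (auto simp: mult_Iso compose_def extend_iso_def[of A h] fun_eq_iff)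
qed

lemma extend_iso_one:
  assumes "A \<subseteq> M" "\<And>x. x \<in> A \<Longrightarrow> f x = x"
  shows "extend_iso A f = \<one>\<^bsub>Iso M d\<^esub>"
proof -
  have "move f (position A y) = position A y" for y
    using assms(2) by (force simp: move_def position_def)
  then show ?thesis
    using transport(1) position_in_positions[OF assms(1)]
    by (auto simp: extend_iso_def one_Iso fun_eq_iff apply_inv_Iso)
qed

text \<open>The composition law applied to the identity of \<open>A\<close> yields a left inverse,
  which suffices in a group.\<close>

lemma extend_iso_inv:
  assumes "A \<subseteq> M" "B \<subseteq> M" "isometry_between d A B f" "isometry_between d B A g"
    and "\<And>x. x \<in> A \<Longrightarrow> g (f x) = x"
  shows "extend_iso B g = inv\<^bsub>Iso M d\<^esub> (extend_iso A f)"
proof -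
  have "\<one>\<^bsub>Iso M d\<^esub> = extend_iso B g \<otimes>\<^bsub>Iso M d\<^esub> extend_iso A f"
    using extend_iso_mult[OF assms(1,2,1,3,4), of "\<lambda>x. x"] extend_iso_one[OF assms(1), of "\<lambda>x. x"]
      assms(5) by simp
  then show ?thesis
    using assms by (intro Iso.inv_equality[symmetric]) (auto intro: extend_iso_closed)
qed

end


section \<open>Free groups acting by isometries\<close>

lemma carrier_free_groupD: "w \<in> carrier (free_group S) \<Longrightarrow> w \<in> lists (S \<times> UNIV)"
  by (simp add: free_group_def)

lemma free_group_mono: "S \<subseteq> T \<Longrightarrow> carrier (free_group S) \<subseteq> carrier (free_group T)"
  by (auto simp: free_group_def)

lemma generator_in_free_group: "s \<in> S \<Longrightarrow> [(s, True)] \<in> carrier (free_group S)"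
  by (simp add: free_group_def reduced_def)

lemma free_ext_Cons:
  "free_ext G \<phi> ((s, b) # w) = (if b then \<phi> s else inv\<^bsub>G\<^esub> (\<phi> s)) \<otimes>\<^bsub>G\<^esub> free_ext G \<phi> w"
  by (simp add: free_ext_def)

lemma free_ext_cong:
  assumes "w \<in> lists (S \<times> UNIV)" "\<And>s. s \<in> S \<Longrightarrow> \<phi> s = \<psi> s"
  shows "free_ext G \<phi> w = free_ext G \<psi> w"
  using assms(1)
proof (induction w)
  case (Cons a w)
  with assms(2) show ?case by (cases a) (auto simp: free_ext_Cons)
qed (simp add: free_ext_def)

text \<open>Homomorphisms commute with letterwise evaluation, so the word need not be
  reduced.\<close>

lemma free_ext_comp_hom:
  assumes "group G" "group H" "h \<in> hom G H" "\<phi> \<in> S \<rightarrow> carrier G" "w \<in> lists (S \<times> UNIV)"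
  shows "free_ext H (\<lambda>s. h (\<phi> s)) w = h (free_ext G \<phi> w)"
proof -
  interpret group_hom G H h
    using assms by (simp add: group_hom_def group_hom_axioms_def)
  show ?thesis
    using assms(5)
  proof (induction w)
    case (Cons a w)
    obtain s b where a: "a = (s, b)" by (cases a)
    with Cons.hyps have "s \<in> S" and w: "w \<in> lists (S \<times> UNIV)" by auto
    then have "\<phi> s \<in> carrier G" "free_ext G \<phi> w \<in> carrier G"
      using assms(4) free_ext_closed[OF assms(1,4) w] by auto
    then show ?case using Cons.IH w by (simp add: a free_ext_Cons)
  qed (simp add: free_ext_def)
qed

section \<open>Restriction to invariant subsets\<close>

lemma restrict_Iso:
  assumes "f \<in> carrier (Iso M d)" "Z \<subseteq> M" "f ` Z = Z"
  shows "restrict f Z \<in> carrier (Iso Z d)"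
  unfolding carrier_Iso
proof
  have "inj_on f Z" using IsoD(3)[OF assms(1)] assms(2) by (rule inj_on_subset)
  then show "isometry_between d Z Z (restrict f Z)"
    using IsoD(6)[OF assms(1)] assms(2,3) by (intro isometry_betweenI) auto
qed simp

lemma restrict_mult_Iso:
  assumes "f \<in> carrier (Iso M d)" "g \<in> carrier (Iso M d)" "Z \<subseteq> M" "f ` Z = Z" "g ` Z = Z"
  shows "restrict (f \<otimes>\<^bsub>Iso M d\<^esub> g) Z = restrict f Z \<otimes>\<^bsub>Iso Z d\<^esub> restrict g Z"
proof -
  have "restrict f Z \<in> carrier (Iso Z d)" "restrict g Z \<in> carrier (Iso Z d)"
    using assms by (auto intro: restrict_Iso)
  moreover have "\<And>x. x \<in> Z \<Longrightarrow> g x \<in> Z" using assms(5) by blast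
  ultimately show ?thesis
    using assms(1-3)
    by (auto simp: mult_Iso compose_def restrict_def fun_eq_iff subset_iff)
qed

lemma restrict_inv_Iso:
  assumes f: "f \<in> carrier (Iso M d)" and Z: "Z \<subseteq> M" "f ` Z = Z"
  shows "(inv\<^bsub>Iso M d\<^esub> f) ` Z = Z"
    "restrict (inv\<^bsub>Iso M d\<^esub> f) Z = inv\<^bsub>Iso Z d\<^esub> (restrict f Z)"
proof -
  interpret M: group "Iso M d" by (rule group_Iso)
  interpret Z: group "Iso Z d" by (rule group_Iso)
  have "(inv\<^bsub>Iso M d\<^esub> f) ` f ` Z = Z"
    using inv_Iso_apply[OF f] Z(1) by (force simp: image_image subset_iff)
  then show inv: "(inv\<^bsub>Iso M d\<^esub> f) ` Z = Z" by (simp add: Z(2))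
  have "restrict (inv\<^bsub>Iso M d\<^esub> f) Z \<otimes>\<^bsub>Iso Z d\<^esub> restrict f Z = restrict \<one>\<^bsub>Iso M d\<^esub> Z"
    using restrict_mult_Iso[OF _ f Z(1) inv Z(2)] f by simp
  also have "\<dots> = \<one>\<^bsub>Iso Z d\<^esub>"
    using Z(1) by (auto simp: one_Iso restrict_def fun_eq_iff)
  finally show "restrict (inv\<^bsub>Iso M d\<^esub> f) Z = inv\<^bsub>Iso Z d\<^esub> (restrict f Z)"
    using f Z inv by (intro Z.inv_equality[symmetric] restrict_Iso[of _ M]) simp_all
qed

text \<open>Restriction is multiplicative only for isometries that preserve \<open>Z\<close>, so the
  induction carries invariance along with the equation.\<close>

lemma free_ext_restrict:
  assumes \<psi>: "\<psi> \<in> S \<rightarrow> carrier (Iso M d)" and Z: "Z \<subseteq> M" "\<And>s. s \<in> S \<Longrightarrow> \<psi> s ` Z = Z"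
    and w: "w \<in> lists (S \<times> UNIV)"
  shows "free_ext (Iso M d) \<psi> w ` Z = Z \<and>
    free_ext (Iso Z d) (\<lambda>s. restrict (\<psi> s) Z) w = restrict (free_ext (Iso M d) \<psi> w) Z"
  using w
proof (induction w)
  case Nil
  then show ?case using Z(1) by (auto simp: free_ext_def one_Iso restrict_def fun_eq_iff subset_iff)
next
  case (Cons a w)
  interpret M: group "Iso M d" by (rule group_Iso)
  obtain s b where a: "a = (s, b)" by (cases a)
  with Cons.hyps have s: "s \<in> S" and w: "w \<in> lists (S \<times> UNIV)" by auto
  define f where "f = (if b then \<psi> s else inv\<^bsub>Iso M d\<^esub> (\<psi> s))"
  define g where "g = free_ext (Iso M d) \<psi> w"
  have \<psi>s: "\<psi> s \<in> carrier (Iso M d)" using \<psi> s by auto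
  have f: "f \<in> carrier (Iso M d)" "f ` Z = Z"
    "restrict f Z = (if b then restrict (\<psi> s) Z else inv\<^bsub>Iso Z d\<^esub> (restrict (\<psi> s) Z))"
    using restrict_inv_Iso[OF \<psi>s Z(1) Z(2)[OF s]] \<psi>s Z(2)[OF s] by (simp_all add: f_def)
  have g: "g \<in> carrier (Iso M d)" "g ` Z = Z"
    using free_ext_closed[OF group_Iso \<psi> w] Cons.IH w by (simp_all add: g_def)
  have "(f \<otimes>\<^bsub>Iso M d\<^esub> g) ` Z = f ` g ` Z"
    unfolding image_image
    using f(1) g(1) Z(1) by (intro image_cong refl) (auto simp: mult_Iso compose_def)
  moreover have "free_ext (Iso Z d) (\<lambda>s. restrict (\<psi> s) Z) (a # w) =
      restrict f Z \<otimes>\<^bsub>Iso Z d\<^esub> restrict g Z"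
    using Cons.IH by (simp only: a free_ext_Cons f(3) g_def)
  moreover have "free_ext (Iso M d) \<psi> (a # w) = f \<otimes>\<^bsub>Iso M d\<^esub> g"
    by (simp only: a free_ext_Cons f_def g_def)
  ultimately show ?case
    using restrict_mult_Iso[OF f(1) g(1) Z(1) f(2) g(2)] by (simp only: f(2) g(2) simp_thms)
qed

section \<open>The group generated by the chosen isometries\<close>

lemma image_group_subgroup:
  assumes "\<phi> \<in> nonid_partial_isometries X d \<rightarrow> carrier (Iso Z d)"
  shows "subgroup (carrier (image_group d X Z \<phi>)) (Iso Z d)"
proof -
  interpret group_hom "free_isometries d X" "Iso Z d" "free_ext (Iso Z d) \<phi>"
    using free_ext_hom[OF group_Iso assms]
    by (simp add: group_hom_def group_hom_axioms_def group_free_group group_Iso)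
  show ?thesis using img_is_subgroup by (simp add: image_group_def)
qed

lemma image_group_eq:
  "image_group d X Z \<phi> = (Iso Z d)\<lparr>carrier := carrier (image_group d X Z \<phi>)\<rparr>"
  by (simp add: image_group_def)

lemma group_image_group:
  assumes "\<phi> \<in> nonid_partial_isometries X d \<rightarrow> carrier (Iso Z d)"
  shows "group (image_group d X Z \<phi>)"
  using group.subgroup_imp_group[OF group_Iso image_group_subgroup[OF assms]]
  by (simp flip: image_group_eq)

lemma generator_in_image_group:
  assumes "\<phi> \<in> nonid_partial_isometries X d \<rightarrow> carrier (Iso Z d)"
  shows "\<phi> \<in> nonid_partial_isometries X d \<rightarrow> carrier (image_group d X Z \<phi>)"
proof
  fix p assume p: "p \<in> nonid_partial_isometries X d"
  show "\<phi> p \<in> carrier (image_group d X Z \<phi>)"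
    using free_ext_generator[OF group_Iso assms p] generator_in_free_group[OF p]
    by (force simp: image_group_def)
qed

text \<open>Every element is the value of a word in the generators, and a homomorphism is determined
  on such values.\<close>

lemma hom_image_group_unique:
  assumes \<phi>: "\<phi> \<in> nonid_partial_isometries X d \<rightarrow> carrier (Iso Z d)"
    and H: "group H" and h: "h \<in> hom (image_group d X Z \<phi>) H" "h' \<in> hom (image_group d X Z \<phi>) H"
    and eq: "\<And>p. p \<in> nonid_partial_isometries X d \<Longrightarrow> h (\<phi> p) = h' (\<phi> p)"
    and g: "g \<in> carrier (image_group d X Z \<phi>)"
  shows "h g = h' g"
proof -
  let ?I = "image_group d X Z \<phi>" and ?P = "nonid_partial_isometries X d"
  obtain w where w: "w \<in> lists (?P \<times> UNIV)" "g = free_ext (Iso Z d) \<phi> w"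
    using g carrier_free_groupD by (force simp: image_group_def)
  note I = group_image_group[OF \<phi>]
  \<comment> \<open>Inclusion is a homomorphism, so a word has the same value in the subgroup, with
    its own inverses, as in \<open>Iso Z d\<close>.\<close>
  have "(\<lambda>x. x) \<in> hom ?I (Iso Z d)"
    using subgroup.subset[OF image_group_subgroup[OF \<phi>]]
    by (auto simp: hom_def image_group_def)
  from free_ext_comp_hom[OF I group_Iso this generator_in_image_group[OF \<phi>] w(1)]
  have g': "g = free_ext ?I \<phi> w" using w by simp
  have "h g = free_ext H (\<lambda>s. h (\<phi> s)) w"
    using free_ext_comp_hom[OF I H h(1) generator_in_image_group[OF \<phi>] w(1)] g' by simp
  also have "\<dots> = free_ext H (\<lambda>s. h' (\<phi> s)) w"
    using w(1) eq by (rule free_ext_cong)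
  also have "\<dots> = h' g"
    using free_ext_comp_hom[OF I H h(2) generator_in_image_group[OF \<phi>] w(1)] g' by simp
  finally show ?thesis .
qed


section \<open>Coherent S-extensions\<close>

text \<open>Translates graphs into the functions that \<open>extend_iso\<close> takes; meaningful
  only on the domain of a single-valued relation.\<close>

definition graph_fun :: "('a \<times> 'b) set \<Rightarrow> 'a \<Rightarrow> 'b" where
  "graph_fun p x = (THE y. (x, y) \<in> p)"

lemma isometry_between_inv_into:
  assumes "isometry_between d A B f"
  shows "isometry_between d B A (inv_into A f)"
proof -
  have b: "bij_betw f A B" using assms by (simp add: isometry_between_def)
  have "d (inv_into A f x) (inv_into A f y) = d x y" if "x \<in> B" "y \<in> B" for x y
    using isometry_betweenD(5)[OF assms, of "inv_into A f x" "inv_into A f y"] that b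
      bij_betw_apply[OF bij_betw_inv_into[OF b]]
    by (simp add: bij_betw_inv_into_right)
  with bij_betw_inv_into[OF b] show ?thesis by (simp add: isometry_between_def)
qed

lemma nonid_partial_isometries_mono:
  "X \<subseteq> X' \<Longrightarrow> nonid_partial_isometries X d \<subseteq> nonid_partial_isometries X' d"
  unfolding nonid_partial_isometries_def partial_isometries_def by blast

lemma nonid_partial_isometry:
  assumes "p \<in> nonid_partial_isometries X d"
  shows "Domain p \<subseteq> X" "Range p \<subseteq> X" "isometry_between d (Domain p) (Range p) (graph_fun p)"
    "(x, y) \<in> p \<Longrightarrow> graph_fun p x = y" "p\<inverse> \<in> nonid_partial_isometries X d"
    "x \<in> Domain p \<Longrightarrow> graph_fun (p\<inverse>) (graph_fun p x) = x"
proof -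
  obtain A B f where p: "p = (\<lambda>x. (x, f x)) ` A" "A \<subseteq> X" "B \<subseteq> X" and f: "isometry_between d A B f"
    and nid: "\<not> p \<subseteq> Id"
    using assms unfolding nonid_partial_isometries_def partial_isometries_def by blast
  note fD = isometry_betweenD[OF f]
  have dom: "Domain p = A" and ran: "Range p = B" using p fD(1) by auto
  have gf: "graph_fun p x = f x" if "x \<in> A" for x
    using that p by (auto simp: graph_fun_def)
  show "Domain p \<subseteq> X" "Range p \<subseteq> X" using dom ran p by auto
  show "isometry_between d (Domain p) (Range p) (graph_fun p)"
    using f gf unfolding dom ran isometry_between_def by (simp cong: bij_betw_cong)
  show "(x, y) \<in> p \<Longrightarrow> graph_fun p x = y" using gf p by auto
  \<comment> \<open>The converse is put in the form of a graph over \<open>B\<close>, as membership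
    in \<open>partial_isometries\<close> requires.\<close>
  have conv: "p\<inverse> = (\<lambda>y. (y, inv_into A f y)) ` B"
  proof -
    have "(\<lambda>y. (y, inv_into A f y)) ` B = (\<lambda>x. (f x, x)) ` A"
      unfolding fD(1)[symmetric] image_image using fD(3) by (intro image_cong refl) simp
    then show ?thesis unfolding p(1) by auto
  qed
  have "p\<inverse> \<in> partial_isometries X d"
    unfolding partial_isometries_def
    by (intro CollectI exI conjI) (rule conv p(2,3) isometry_between_inv_into[OF f])+
  moreover have "\<not> p\<inverse> \<subseteq> Id" using nid by auto
  ultimately show "p\<inverse> \<in> nonid_partial_isometries X d"
    by (simp add: nonid_partial_isometries_def)
  show "graph_fun (p\<inverse>) (graph_fun p x) = x" if "x \<in> Domain p"
  proof -
    have x: "x \<in> A" using that dom by simp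
    then have "y = x" if "(y, f x) \<in> p" for y using that fD(3) p by (auto dest: inj_onD)
    moreover have "(x, f x) \<in> p" using x p by auto
    ultimately show ?thesis unfolding gf[OF x] by (auto simp: graph_fun_def)
  qed
qed

section \<open>Construction of coherent S-extensions\<close>

context finite_ultrahomogeneous
begin

lemma extend_iso_hom:
  assumes "A \<subseteq> M"
  shows "extend_iso A \<in> hom (Iso A d) (Iso M d)"
proof (rule homI)
  fix f assume "f \<in> carrier (Iso A d)"
  then show "extend_iso A f \<in> carrier (Iso M d)"
    using extend_iso_closed[OF assms assms] IsoD(7) by blast
next
  fix f g assume fg: "f \<in> carrier (Iso A d)" "g \<in> carrier (Iso A d)"
  then show "extend_iso A (f \<otimes>\<^bsub>Iso A d\<^esub> g) = extend_iso A f \<otimes>\<^bsub>Iso M d\<^esub> extend_iso A g"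
    using assms IsoD(7) by (intro extend_iso_mult) (auto simp: mult_Iso compose_def)
qed

text \<open>Extension from \<open>Z\<^sub>1\<close> to \<open>M\<close> is a group homomorphism
  whose values agree with the original isometries on \<open>Z\<^sub>1\<close>; this yields both the
  coherence homomorphism and its injectivity.\<close>

lemma coherent_extension:
  assumes X: "X\<^sub>1 \<subseteq> X\<^sub>2" "X\<^sub>2 \<subseteq> M" and Z\<^sub>1: "Z\<^sub>1 \<subseteq> M"
    and min: "minimal_S_extension d X\<^sub>1 Z\<^sub>1 \<phi>\<^sub>1"
  shows "\<exists>Z\<^sub>2 \<phi>\<^sub>2. Z\<^sub>2 \<subseteq> M \<and> finite Z\<^sub>2 \<and> minimal_S_extension d X\<^sub>2 Z\<^sub>2 \<phi>\<^sub>2 \<and>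
    coherent d X\<^sub>1 Z\<^sub>1 \<phi>\<^sub>1 X\<^sub>2 Z\<^sub>2 \<phi>\<^sub>2"
proof -
  let ?P1 = "nonid_partial_isometries X\<^sub>1 d" and ?P2 = "nonid_partial_isometries X\<^sub>2 d"
  have P: "?P1 \<subseteq> ?P2" using X(1) by (rule nonid_partial_isometries_mono)
  have XZ: "X\<^sub>1 \<subseteq> Z\<^sub>1" and \<phi>\<^sub>1: "\<phi>\<^sub>1 \<in> ?P1 \<rightarrow> carrier (Iso Z\<^sub>1 d)"
    and \<phi>\<^sub>1_ext: "\<And>p x y. p \<in> ?P1 \<Longrightarrow> (x, y) \<in> p \<Longrightarrow> \<phi>\<^sub>1 p x = y"
    and \<phi>\<^sub>1_inv: "\<And>p. p \<in> ?P1 \<Longrightarrow> \<phi>\<^sub>1 (p\<inverse>) = inv\<^bsub>Iso Z\<^sub>1 d\<^esub> (\<phi>\<^sub>1 p)"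
    and \<phi>\<^sub>1_min: "\<And>z. z \<in> Z\<^sub>1 \<Longrightarrow>
      \<exists>g\<in>carrier (free_isometries d X\<^sub>1). \<exists>x\<in>X\<^sub>1. z = free_ext (Iso Z\<^sub>1 d) \<phi>\<^sub>1 g x"
    using min by (fastforce simp: minimal_S_extension_def S_extension_def)+
  note ext_Z\<^sub>1 = extend_iso_eq[OF Z\<^sub>1 Z\<^sub>1 IsoD(7)]
  \<comment> \<open>Partial isometries of \<open>X\<^sub>1\<close> must follow
    \<open>\<phi>\<^sub>1\<close>, so they are extended from all of \<open>Z\<^sub>1\<close>; the
    others are extended from their own domain.\<close>
  define \<psi> where "\<psi> p = (if p \<in> ?P1 then extend_iso Z\<^sub>1 (\<phi>\<^sub>1 p)
    else extend_iso (Domain p) (graph_fun p))" for p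
  have DR: "Domain p \<subseteq> M" "Range p \<subseteq> M" if "p \<in> ?P2" for p
    using nonid_partial_isometry(1,2)[OF that] X(2) by auto
  have \<psi>: "\<psi> \<in> ?P2 \<rightarrow> carrier (Iso M d)"
  proof
    fix p assume p: "p \<in> ?P2"
    show "\<psi> p \<in> carrier (Iso M d)"
    proof (cases "p \<in> ?P1")
      case True
      then show ?thesis
        using \<phi>\<^sub>1 extend_iso_hom[OF Z\<^sub>1] by (auto simp: \<psi>_def hom_def)
    next
      case False
      then show ?thesis
        using extend_iso_closed[OF DR[OF p] nonid_partial_isometry(3)[OF p]] by (simp add: \<psi>_def)
    qed
  qed
  have \<psi>_ext: "\<psi> p x = y" if p: "p \<in> ?P2" and xy: "(x, y) \<in> p" for p x y
  proof (cases "p \<in> ?P1")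
    case True
    then have "x \<in> Z\<^sub>1" using nonid_partial_isometry(1)[OF True] xy XZ by auto
    then show ?thesis using True \<phi>\<^sub>1 \<phi>\<^sub>1_ext[OF True xy] ext_Z\<^sub>1[of "\<phi>\<^sub>1 p" x] by (auto simp: \<psi>_def)
  next
    case False
    then show ?thesis
      using extend_iso_eq[OF DR[OF p] nonid_partial_isometry(3)[OF p], of x]
        nonid_partial_isometry(4)[OF p xy] xy
      by (auto simp: \<psi>_def)
  qed
  have \<psi>_inv: "\<psi> (p\<inverse>) = inv\<^bsub>Iso M d\<^esub> (\<psi> p)" if p: "p \<in> ?P2" for p
  proof (cases "p \<in> ?P1")
    case True
    interpret h: group_hom "Iso Z\<^sub>1 d" "Iso M d" "extend_iso Z\<^sub>1"
      using extend_iso_hom[OF Z\<^sub>1] by (simp add: group_hom_def group_hom_axioms_def group_Iso)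
    have "\<phi>\<^sub>1 p \<in> carrier (Iso Z\<^sub>1 d)" using True \<phi>\<^sub>1 by blast
    then show ?thesis
      using True nonid_partial_isometry(5)[OF True] \<phi>\<^sub>1_inv[OF True] by (simp add: \<psi>_def)
  next
    case False
    \<comment> \<open>As \<open>?P1\<close> is closed under converses, \<open>p\<close> and its
      converse fall under the same branch of \<open>\<psi>\<close>.\<close>
    then have "p\<inverse> \<notin> ?P1" using nonid_partial_isometry(5)[of "p\<inverse>" X\<^sub>1 d] by auto
    with False show ?thesis
      using extend_iso_inv[OF DR[OF p] nonid_partial_isometry(3)[OF p], of "graph_fun (p\<inverse>)"]
        nonid_partial_isometry(3)[OF nonid_partial_isometry(5)[OF p]]
        nonid_partial_isometry(6)[OF p]
      by (simp add: \<psi>_def)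
  qed
  let ?\<psi> = "free_ext (Iso M d) \<psi>"
  define Z\<^sub>2 where "Z\<^sub>2 = {?\<psi> w x | w x. w \<in> carrier (free_isometries d X\<^sub>2) \<and> x \<in> X\<^sub>2}"
  have \<psi>_closed: "?\<psi> w \<in> carrier (Iso M d)" if "w \<in> lists (?P2 \<times> UNIV)" for w
    using free_ext_closed[OF group_Iso \<psi> that] .
  have Z\<^sub>2: "Z\<^sub>2 \<subseteq> M"
    using IsoD(2)[OF \<psi>_closed[OF carrier_free_groupD]] X(2) by (fastforce simp: Z\<^sub>2_def)
  have fin: "finite Z\<^sub>2" using Z\<^sub>2 finite_M by (rule finite_subset)
  \<comment> \<open>Prepending the letter \<open>p\<close> to a word keeps the orbit inside itself;
    finiteness gives equality.\<close>
  have inv: "\<psi> p ` Z\<^sub>2 = Z\<^sub>2" if p: "p \<in> ?P2" for p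
  proof (rule endo_inj_surj[OF fin])
    have \<psi>p: "\<psi> p \<in> carrier (Iso M d)" using \<psi> p by auto
    show "inj_on (\<psi> p) Z\<^sub>2" using IsoD(3)[OF \<psi>p] Z\<^sub>2 by (rule inj_on_subset)
    show "\<psi> p ` Z\<^sub>2 \<subseteq> Z\<^sub>2"
    proof
      fix z assume "z \<in> \<psi> p ` Z\<^sub>2"
      then obtain w x where w: "w \<in> carrier (free_isometries d X\<^sub>2)" and x: "x \<in> X\<^sub>2"
        and z: "z = \<psi> p (?\<psi> w x)" by (auto simp: Z\<^sub>2_def)
      let ?u = "[(p, True)] \<otimes>\<^bsub>free_isometries d X\<^sub>2\<^esub> w"
      have u: "?u \<in> carrier (free_isometries d X\<^sub>2)"
        using group.is_monoid[OF group_free_group] generator_in_free_group[OF p] w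
        by (rule monoid.m_closed)
      have "?\<psi> ?u = \<psi> p \<otimes>\<^bsub>Iso M d\<^esub> ?\<psi> w"
        using hom_mult[OF free_ext_hom[OF group_Iso \<psi>] generator_in_free_group[OF p] w]
          free_ext_generator[OF group_Iso \<psi> p] by simp
      then have "?\<psi> ?u x = z"
        using mult_Iso[OF \<psi>p \<psi>_closed[OF carrier_free_groupD[OF w]]] x X(2) z
        by (auto simp: compose_def)
      with u x show "z \<in> Z\<^sub>2" by (auto simp: Z\<^sub>2_def)
    qed
  qed
  define \<phi>\<^sub>2 where "\<phi>\<^sub>2 = (\<lambda>p. restrict (\<psi> p) Z\<^sub>2)"
  have \<phi>\<^sub>2: "\<phi>\<^sub>2 \<in> ?P2 \<rightarrow> carrier (Iso Z\<^sub>2 d)"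
    using restrict_Iso[OF funcset_mem[OF \<psi>] Z\<^sub>2 inv] by (simp add: \<phi>\<^sub>2_def)
  have free_\<phi>\<^sub>2: "?\<psi> w ` Z\<^sub>2 = Z\<^sub>2" "free_ext (Iso Z\<^sub>2 d) \<phi>\<^sub>2 w = restrict (?\<psi> w) Z\<^sub>2"
    if "w \<in> lists (?P2 \<times> UNIV)" for w
    using free_ext_restrict[OF \<psi> Z\<^sub>2 inv that] unfolding \<phi>\<^sub>2_def by blast+
  have X\<^sub>2: "X\<^sub>2 \<subseteq> Z\<^sub>2"
  proof
    fix x assume x: "x \<in> X\<^sub>2"
    then have "?\<psi> [] x = x" using X(2) by (auto simp: free_ext_def one_Iso)
    moreover have "[] \<in> carrier (free_isometries d X\<^sub>2)" by (simp add: free_group_def)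
    ultimately show "x \<in> Z\<^sub>2" unfolding Z\<^sub>2_def using x by force
  qed
  have free_\<phi>\<^sub>1: "?\<psi> w = extend_iso Z\<^sub>1 (free_ext (Iso Z\<^sub>1 d) \<phi>\<^sub>1 w)"
    if w: "w \<in> lists (?P1 \<times> UNIV)" for w
  proof -
    have "?\<psi> w = free_ext (Iso M d) (\<lambda>p. extend_iso Z\<^sub>1 (\<phi>\<^sub>1 p)) w"
      using w by (rule free_ext_cong) (simp add: \<psi>_def)
    also have "\<dots> = extend_iso Z\<^sub>1 (free_ext (Iso Z\<^sub>1 d) \<phi>\<^sub>1 w)"
      using extend_iso_hom[OF Z\<^sub>1] \<phi>\<^sub>1 w by (rule free_ext_comp_hom[OF group_Iso group_Iso])
    finally show ?thesis .
  qed
  have "S_extension d X\<^sub>2 Z\<^sub>2 \<phi>\<^sub>2"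
    unfolding S_extension_def
  proof (intro conjI ballI)
    show "Metric_space Z\<^sub>2 d" using Z\<^sub>2 by (rule subspace)
    show "finite X\<^sub>2" using X(2) finite_M by (rule finite_subset)
    show "X\<^sub>2 \<subseteq> Z\<^sub>2" by fact
    fix p assume p: "p \<in> ?P2"
    show "\<phi>\<^sub>2 p \<in> carrier (Iso Z\<^sub>2 d)" using \<phi>\<^sub>2 p by auto
    show "\<phi>\<^sub>2 (p\<inverse>) = inv\<^bsub>Iso Z\<^sub>2 d\<^esub> (\<phi>\<^sub>2 p)"
      using restrict_inv_Iso(2)[OF funcset_mem[OF \<psi> p] Z\<^sub>2 inv[OF p]] \<psi>_inv[OF p]
      by (simp add: \<phi>\<^sub>2_def)
    have "Domain p \<subseteq> Z\<^sub>2" using nonid_partial_isometry(1)[OF p] X\<^sub>2 by (rule order_trans)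
    then have "\<And>x y. (x, y) \<in> p \<Longrightarrow> x \<in> Z\<^sub>2" by blast
    then show "case xy of (x, y) \<Rightarrow> \<phi>\<^sub>2 p x = y" if "xy \<in> p" for xy
      using \<psi>_ext[OF p] that by (auto simp: \<phi>\<^sub>2_def)
  qed
  moreover have "\<exists>g\<in>carrier (free_isometries d X\<^sub>2). \<exists>x\<in>X\<^sub>2. z = free_ext (Iso Z\<^sub>2 d) \<phi>\<^sub>2 g x"
    if "z \<in> Z\<^sub>2" for z
  proof -
    obtain w x where w: "w \<in> carrier (free_isometries d X\<^sub>2)" and x: "x \<in> X\<^sub>2" "z = ?\<psi> w x"
      using \<open>z \<in> Z\<^sub>2\<close> unfolding Z\<^sub>2_def by blast
    then have "z = free_ext (Iso Z\<^sub>2 d) \<phi>\<^sub>2 w x"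
      using free_\<phi>\<^sub>2(2)[OF carrier_free_groupD[OF w]] X\<^sub>2 by auto
    with w x show ?thesis by blast
  qed
  ultimately have min2: "minimal_S_extension d X\<^sub>2 Z\<^sub>2 \<phi>\<^sub>2" by (simp add: minimal_S_extension_def)
  \<comment> \<open>Minimality of \<open>Z\<^sub>1\<close> enters here: its points are reached from
    \<open>X\<^sub>1\<close> by words, and evaluating these in \<open>M\<close> gives the same
    points.\<close>
  have Z\<^sub>1\<^sub>2: "Z\<^sub>1 \<subseteq> Z\<^sub>2"
  proof
    fix z assume "z \<in> Z\<^sub>1"
    then obtain w x where w: "w \<in> carrier (free_isometries d X\<^sub>1)" and x: "x \<in> X\<^sub>1"
      and z: "z = free_ext (Iso Z\<^sub>1 d) \<phi>\<^sub>1 w x"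
      using \<phi>\<^sub>1_min by blast
    have w': "w \<in> lists (?P1 \<times> UNIV)" using w by (rule carrier_free_groupD)
    have "?\<psi> w x = z"
      using free_\<phi>\<^sub>1[OF w'] ext_Z\<^sub>1[OF free_ext_closed[OF group_Iso \<phi>\<^sub>1 w']] x XZ z by auto
    with w x X(1) free_group_mono[OF P] show "z \<in> Z\<^sub>2" by (auto simp: Z\<^sub>2_def)
  qed
  let ?I1 = "image_group d X\<^sub>1 Z\<^sub>1 \<phi>\<^sub>1" and ?I2 = "image_group d X\<^sub>2 Z\<^sub>2 \<phi>\<^sub>2"
  \<comment> \<open>Extend to \<open>M\<close>, then restrict to the invariant set
    \<open>Z\<^sub>2\<close>. As no word enters the definition, \<open>h\<close> is independent of
    the representation of \<open>g\<close>.\<close>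
  define h where "h = (\<lambda>g\<in>carrier ?I1. restrict (extend_iso Z\<^sub>1 g) Z\<^sub>2)"
  have I1: "g \<in> carrier (Iso Z\<^sub>1 d)" "extend_iso Z\<^sub>1 g ` Z\<^sub>2 = Z\<^sub>2" "h g \<in> carrier ?I2"
    "extend_iso Z\<^sub>1 g \<in> carrier (Iso M d)"
    if g: "g \<in> carrier ?I1" for g
  proof -
    obtain w where w: "w \<in> carrier (free_isometries d X\<^sub>1)" "g = free_ext (Iso Z\<^sub>1 d) \<phi>\<^sub>1 w"
      using g by (auto simp: image_group_def)
    have w1: "w \<in> lists (?P1 \<times> UNIV)" using w(1) by (rule carrier_free_groupD)
    have w2: "w \<in> carrier (free_isometries d X\<^sub>2)" using w(1) free_group_mono[OF P] by auto
    note w3 = carrier_free_groupD[OF w2]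
    show g1: "g \<in> carrier (Iso Z\<^sub>1 d)" using w free_ext_closed[OF group_Iso \<phi>\<^sub>1 w1] by simp
    show "extend_iso Z\<^sub>1 g ` Z\<^sub>2 = Z\<^sub>2" using free_\<phi>\<^sub>2(1)[OF w3] free_\<phi>\<^sub>1[OF w1] w by simp
    show "extend_iso Z\<^sub>1 g \<in> carrier (Iso M d)" using g1 extend_iso_hom[OF Z\<^sub>1] by (auto simp: hom_def)
    have "h g = free_ext (Iso Z\<^sub>2 d) \<phi>\<^sub>2 w" using free_\<phi>\<^sub>2(2)[OF w3] free_\<phi>\<^sub>1[OF w1] w g by (simp add: h_def)
    then show "h g \<in> carrier ?I2" using w2 by (simp add: image_group_def)
  qed
  have gen: "h (\<phi>\<^sub>1 p) = \<phi>\<^sub>2 p" if p: "p \<in> ?P1" for p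
    using generator_in_image_group[OF \<phi>\<^sub>1] p by (auto simp: h_def \<phi>\<^sub>2_def \<psi>_def)
  have h: "h \<in> hom ?I1 ?I2"
  proof (rule homI)
    fix f g assume f: "f \<in> carrier ?I1" and g: "g \<in> carrier ?I1"
    have fg: "f \<otimes>\<^bsub>?I1\<^esub> g \<in> carrier ?I1"
      using group.is_monoid[OF group_image_group[OF \<phi>\<^sub>1]] f g by (rule monoid.m_closed)
    have "h (f \<otimes>\<^bsub>?I1\<^esub> g) = restrict (extend_iso Z\<^sub>1 (f \<otimes>\<^bsub>Iso Z\<^sub>1 d\<^esub> g)) Z\<^sub>2"
      using fg by (simp add: h_def image_group_def)
    also have "\<dots> = restrict (extend_iso Z\<^sub>1 f) Z\<^sub>2 \<otimes>\<^bsub>Iso Z\<^sub>2 d\<^esub> restrict (extend_iso Z\<^sub>1 g) Z\<^sub>2"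
      using hom_mult[OF extend_iso_hom[OF Z\<^sub>1] I1(1)[OF f] I1(1)[OF g]]
        restrict_mult_Iso[OF I1(4)[OF f] I1(4)[OF g] Z\<^sub>2 I1(2)[OF f] I1(2)[OF g]] by simp
    also have "\<dots> = h f \<otimes>\<^bsub>?I2\<^esub> h g"
      using f g by (simp add: h_def image_group_def)
    finally show "h (f \<otimes>\<^bsub>?I1\<^esub> g) = h f \<otimes>\<^bsub>?I2\<^esub> h g" .
  qed (rule I1)
  \<comment> \<open>On \<open>Z\<^sub>1\<close>, which lies in \<open>Z\<^sub>2\<close>, the map
    \<open>h f\<close> still agrees with \<open>f\<close>.\<close>
  have inj: "inj_on h (carrier ?I1)"
  proof (rule inj_onI)
    fix f g assume f: "f \<in> carrier ?I1" and g: "g \<in> carrier ?I1" and eq: "h f = h g"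
    show "f = g"
    proof (rule Iso_eqI[OF I1(1)[OF f] I1(1)[OF g]])
      fix z assume z: "z \<in> Z\<^sub>1"
      then have "extend_iso Z\<^sub>1 f z = extend_iso Z\<^sub>1 g z"
        using fun_cong[OF eq, of z] f g Z\<^sub>1\<^sub>2 by (auto simp: h_def)
      then show "f z = g z" using ext_Z\<^sub>1[OF I1(1) z] f g by simp
    qed
  qed
  have "coherent d X\<^sub>1 Z\<^sub>1 \<phi>\<^sub>1 X\<^sub>2 Z\<^sub>2 \<phi>\<^sub>2"
    unfolding coherent_def
  proof (intro conjI ballI ex1I[of _ h])
    fix p z assume p: "p \<in> ?P1" and z: "z \<in> Z\<^sub>1"
    then show "\<phi>\<^sub>2 p z = \<phi>\<^sub>1 p z"
      using Z\<^sub>1\<^sub>2 ext_Z\<^sub>1[OF _ z, of "\<phi>\<^sub>1 p"] \<phi>\<^sub>1 by (auto simp: \<phi>\<^sub>2_def \<psi>_def)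
  next
    show "h \<in> extensional (carrier ?I1)" by (simp add: h_def)
  next
    fix h' assume h': "h' \<in> hom ?I1 ?I2 \<and> h' \<in> extensional (carrier ?I1) \<and>
      inj_on h' (carrier ?I1) \<and> (\<forall>p\<in>?P1. h' (\<phi>\<^sub>1 p) = \<phi>\<^sub>2 p)"
    show "h' = h"
    proof (rule extensionalityI[of _ "carrier ?I1"])
      show "h' \<in> extensional (carrier ?I1)" using h' by blast
      show "h \<in> extensional (carrier ?I1)" by (simp add: h_def)
      show "h' g = h g" if "g \<in> carrier ?I1" for g
        using h' h gen that
        by (intro hom_image_group_unique[OF \<phi>\<^sub>1 group_image_group[OF \<phi>\<^sub>2], of h' h g]) auto
    qed
  qed (use Z\<^sub>1\<^sub>2 h inj gen in auto)
  with Z\<^sub>2 fin min2 show ?thesis by blast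
qed

lemma ultraextensive: "ultraextensive M d"
  unfolding ultraextensive_def
proof (intro conjI allI impI)
  show "ultrahomogeneous M d" by (rule ultrahomogeneous_M)
next
  fix X assume X: "X \<subseteq> M"
  \<comment> \<open>The only partial isometry of the empty set is empty, hence contained in
    \<open>Id\<close>, so all conditions on the map are vacuous. Existence of S-extensions is thus
    the case of coherent extension that starts from the empty set.\<close>
  have "minimal_S_extension d {} {} undefined"
    by (auto simp: minimal_S_extension_def S_extension_def nonid_partial_isometries_def
        partial_isometries_def intro: subspace)
  from coherent_extension[OF _ X _ this] show "\<exists>Z \<phi>. Z \<subseteq> M \<and> finite Z \<and> S_extension d X Z \<phi>"
    by (auto simp: minimal_S_extension_def)
qed (rule coherent_extension)

end

theorem theorem7p2:
  fixes Y :: "'a set" and d :: "'a \<Rightarrow> 'a \<Rightarrow> real"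
  assumes "Ultrametric_space Y d" and "finite Y"
  shows "(homogeneous Y d \<longleftrightarrow> ultrahomogeneous Y d) \<and>
         (ultrahomogeneous Y d \<longleftrightarrow> ultraextensive Y d)"
proof (intro conjI iffI)
  interpret Ultrametric_space Y d by fact
  show "ultrahomogeneous Y d" if "homogeneous Y d"
    using that homogeneous_iff_ultrahomogeneous[OF assms(2)] by simp
  show "homogeneous Y d" if "ultrahomogeneous Y d"
    using that homogeneous_iff_ultrahomogeneous[OF assms(2)] by simp
  show "ultraextensive Y d" if "ultrahomogeneous Y d"
  proof -
    interpret finite_ultrahomogeneous Y d using that assms(2) by unfold_locales
    show ?thesis by (rule ultraextensive)
  qed
  show "ultrahomogeneous Y d" if "ultraextensive Y d"
    using that by (simp add: ultraextensive_def)
qed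

end
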